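(* Let $\mu_n$ be the Ising measure on $\Xi_n=\{-1,+1\}^{V_n}$ with surface potential $a(n)$ and pair potential $b(n)$. Assume that for all $n$, $a(n)<0$, and that there exists $b_0>0$ such that $|b(n)|<b_0$ for all $n$. If $$\forall k=1,2,\ldots,\qquad \lim_{n\to\infty} e^{a(n)}\,n^{\frac{d}{2k}}\in\{0,+\infty\},$$ then for any first-order sentence $A$, $$\lim_{n\to\infty}\mu_n(A_n)=0\text{ or }1,$$ where $A_n=\{\eta\in\Xi_n:\eta\models A\}$.
   Context: Lattice torus. Fix a dimension $d$, $p$ with $1\le p\le\infty$, and a parameter $\rho$. For each $n$, $V_n=\{0,\ldots,n-1\}^d$, with all operations on vertices taken componentwise modulo $n$ (periodic boundary conditions). $G_n=(V_n,E_n)$ is the undirected graph in which the neighbors of $x$ are the $y\ne x$ in $V_n$ with $\|y-x\|_p\le\rho$, where the subtraction is taken componentwise modulo $n$ and $\|\cdot\|_p$ is the $L_p$ norm on $\mathbb{R}^d$. Ising measure. $a(n)$ and $b(n)$ are reals depending on $n$, and for $\eta\in\Xi_n=\{-1,+1\}^{V_n}$, $$\mu_n(\eta)=\frac1Z\exp\Big(a(n)\sum_{x\in V_n}\eta(x)+b(n)\sum_{\{x,y\}\in E_n}\eta(x)\eta(y)\Big),$$ where $Z$ (depending on $n$) is the constant making $\mu_n$ a probability measure on $\Xi_n$. Logic. The vocabulary consists of one unary predicate $C$ and some binary predicates, applied to the domain $V_n$. In all structures considered, the list of facts relative to the binary predicates is fixed, so that the associated graph, which joins those pairs $\{x,y\}$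 such that $Rxy$ or $Ryx$ holds for some binary predicate $R$, is the lattice torus $G_n$. Structures thus differ only by their unary facts, and a structure is identified with the configuration $\eta\in\Xi_n$ such that $\eta(x)=+1$ if $Cx$ holds and $\eta(x)=-1$ if $\neg Cx$ holds. First-order formulas are obtained from atoms ($Cx$, $Rxy$, etc.) by negation, conjunction and quantification over variables in the domain; a sentence is a formula all of whose variables are quantified. $\eta\models A$ means that the structure identified with $\eta$ satisfies $A$.
   Formalization: Each binary predicate is assumed to hold of x, y exactly when y−x is congruent mod n to an element of a set of displacements not depending on n; with facts chosen freely for each n (e.g. two predicates swapping roles with the parity of n) the claim fails. *)

theory Defs
  imports "HOL-Probability.Probability" "HOL-Number_Theory.Cong"
begin

section \<open>The lattice torus\<close>

text \<open>The dimension is \<open>d = CARD('d)\<close>.\<close>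

type_synonym 'd vertex = "int ^ 'd"

definition vertices :: "nat \<Rightarrow> 'd::finite vertex set" where
  "vertices n = {x. \<forall>i. 0 \<le> x $ i \<and> x $ i < int n}"

definition lp_norm :: "ereal \<Rightarrow> real ^ 'd::finite \<Rightarrow> real" where
  "lp_norm p x =
     (if p = \<infinity> then infnorm x
      else (\<Sum>i\<in>UNIV. \<bar>x $ i\<bar> powr real_of_ereal p) powr (1 / real_of_ereal p))"

text \<open>Forall integer representatives of \<open>y - x\<close> modulo \<open>n\<close>.\<close>

definition displacements :: "nat \<Rightarrow> 'd::finite vertex \<Rightarrow> 'd vertex \<Rightarrow> (int ^ 'd) set" where
  "displacements n x y = {z. \<forall>i. [z $ i = y $ i - x $ i] (mod int n)}"

text \<open>The norm of \<open>y - x\<close> is the torus norm, that is, the least norm of a representative.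
  The representative in \<open>{0,\<dots>,n-1}\<^sup>d\<close> would not do: adjacency would not be symmetric.\<close>

definition torus_adj :: "ereal \<Rightarrow> real \<Rightarrow> nat \<Rightarrow> 'd::finite vertex \<Rightarrow> 'd vertex \<Rightarrow> bool" where
  "torus_adj p \<rho> n x y \<longleftrightarrow>
     y \<noteq> x \<and> (\<exists>z\<in>displacements n x y. lp_norm p (\<chi> i. real_of_int (z $ i)) \<le> \<rho>)"

definition torus_edges :: "ereal \<Rightarrow> real \<Rightarrow> nat \<Rightarrow> 'd::finite vertex set set" where
  "torus_edges p \<rho> n = {{x, y} | x y. x \<in> vertices n \<and> y \<in> vertices n \<and> torus_adj p \<rho> n x y}"

lemma torus_adj_sym:
  assumes "torus_adj p \<rho> n x y"
  shows "torus_adj p \<rho> n y x"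
proof -
  obtain z where z: "z \<in> displacements n x y" "lp_norm p (\<chi> i. real_of_int (z $ i)) \<le> \<rho>"
    using assms by (auto simp: torus_adj_def)
  have "- z \<in> displacements n y x"
    using z(1) cong_minus_minus_iff by (fastforce simp: displacements_def)
  moreover have "(\<chi> i. real_of_int ((- z) $ i)) = - (\<chi> i. real_of_int (z $ i))"
    by (simp add: vec_eq_iff)
  then have "lp_norm p (\<chi> i. real_of_int ((- z) $ i)) = lp_norm p (\<chi> i. real_of_int (z $ i))"
    by (simp add: lp_norm_def infnorm_neg)
  ultimately show ?thesis
    using assms z(2) by (metis torus_adj_def)
qed


section \<open>The Ising measure\<close>

definition configs :: "nat \<Rightarrow> ('d::finite vertex \<Rightarrow> real) set" where
  "configs n = vertices n \<rightarrow>\<^sub>E {-1, 1}"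

text \<open>For an edge \<open>e = {x, y}\<close> the product over \<open>e\<close> is \<open>\<eta> x * \<eta> y\<close>.\<close>

definition ising_weight ::
  "ereal \<Rightarrow> real \<Rightarrow> real \<Rightarrow> real \<Rightarrow> nat \<Rightarrow> ('d::finite vertex \<Rightarrow> real) \<Rightarrow> real" where
  "ising_weight p \<rho> \<alpha> \<beta> n \<eta> =
     exp (\<alpha> * (\<Sum>x\<in>vertices n. \<eta> x) + \<beta> * (\<Sum>e\<in>torus_edges p \<rho> n. \<Prod>x\<in>e. \<eta> x))"

definition ising ::
  "ereal \<Rightarrow> real \<Rightarrow> real \<Rightarrow> real \<Rightarrow> nat \<Rightarrow> ('d::finite vertex \<Rightarrow> real) measure" where
  "ising p \<rho> \<alpha> \<beta> n =
     (let Z = (\<Sum>\<xi>\<in>configs n. ising_weight p \<rho> \<alpha> \<beta> n (\<xi> :: 'd vertex \<Rightarrow> real))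
      in point_measure (configs n) (\<lambda>\<eta>. ennreal (1 / Z * ising_weight p \<rho> \<alpha> \<beta> n \<eta>)))"

lemma finite_vertices: "finite (vertices n :: 'd::finite vertex set)"
proof (rule finite_subset)
  show "vertices n \<subseteq> vec_lambda ` (UNIV \<rightarrow>\<^sub>E {0..<int n} :: ('d \<Rightarrow> int) set)"
  proof
    fix x :: "'d vertex" assume "x \<in> vertices n"
    then have "vec_nth x \<in> UNIV \<rightarrow>\<^sub>E {0..<int n}"
      by (auto simp: vertices_def)
    then show "x \<in> vec_lambda ` (UNIV \<rightarrow>\<^sub>E {0..<int n})"
      by (metis image_eqI vec_nth_inverse)
  qed
qed (intro finite_imageI finite_PiE; simp)

lemma finite_configs: "finite (configs n)"
  by (simp add: configs_def finite_PiE finite_vertices)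

lemma configs_nonempty: "configs n \<noteq> {}"
  by (simp add: configs_def PiE_eq_empty_iff)

lemma prob_space_ising:
  "prob_space (ising p \<rho> \<alpha> \<beta> n :: ('d::finite vertex \<Rightarrow> real) measure)"
proof
  let ?I = "ising p \<rho> \<alpha> \<beta> n :: ('d vertex \<Rightarrow> real) measure"
  let ?w = "ising_weight p \<rho> \<alpha> \<beta> n :: ('d vertex \<Rightarrow> real) \<Rightarrow> real"
  let ?Z = "\<Sum>\<xi>\<in>configs n. ?w \<xi>"
  have pos: "?Z > 0"
    by (intro sum_pos finite_configs configs_nonempty) (simp add: ising_weight_def)
  have "emeasure ?I (space ?I)
      = (\<Sum>\<eta>\<in>configs n. ennreal (1 / ?Z * ?w \<eta>))"
    by (simp add: ising_def Let_def space_point_measure emeasure_point_measure_finite finite_configs)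
  also have "\<dots> = ennreal (\<Sum>\<eta>\<in>configs n. 1 / ?Z * ?w \<eta>)"
    using pos by (intro sum_ennreal) (simp add: ising_weight_def)
  also have "\<dots> = 1"
    using pos by (simp flip: sum_divide_distrib)
  finally show "emeasure ?I (space ?I) = 1" .
qed


section \<open>First-order logic with one unary predicate and binary predicates indexed by \<open>'r\<close>\<close>

datatype 'r fm =
    Col nat
  | Rel 'r nat nat
  | Equal nat nat
  | Neg "'r fm"
  | Conj "'r fm" "'r fm"
  | Forall nat "'r fm"
  | Exists nat "'r fm"

primrec free_vars :: "'r fm \<Rightarrow> nat set" where
  "free_vars (Col i) = {i}"
| "free_vars (Rel r i j) = {i, j}"
| "free_vars (Equal i j) = {i, j}"
| "free_vars (Neg A) = free_vars A"
| "free_vars (Conj A B) = free_vars A \<union> free_vars B"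
| "free_vars (Forall i A) = free_vars A - {i}"
| "free_vars (Exists i A) = free_vars A - {i}"

definition sentence :: "'r fm \<Rightarrow> bool" where
  "sentence A \<longleftrightarrow> free_vars A = {}"

primrec sat ::
  "'v set \<Rightarrow> ('v \<Rightarrow> bool) \<Rightarrow> ('r \<Rightarrow> 'v \<Rightarrow> 'v \<Rightarrow> bool) \<Rightarrow> (nat \<Rightarrow> 'v) \<Rightarrow> 'r fm \<Rightarrow> bool" where
  "sat V C R s (Col i) \<longleftrightarrow> C (s i)"
| "sat V C R s (Rel r i j) \<longleftrightarrow> R r (s i) (s j)"
| "sat V C R s (Equal i j) \<longleftrightarrow> s i = s j"
| "sat V C R s (Neg A) \<longleftrightarrow> \<not> sat V C R s A"
| "sat V C R s (Conj A B) \<longleftrightarrow> sat V C R s A \<and> sat V C R s B"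
| "sat V C R s (Forall i A) \<longleftrightarrow> (\<forall>v\<in>V. sat V C R (s(i := v)) A)"
| "sat V C R s (Exists i A) \<longleftrightarrow> (\<exists>v\<in>V. sat V C R (s(i := v)) A)"

lemma sat_cong:
  "(\<And>i. i \<in> free_vars A \<Longrightarrow> s i = t i) \<Longrightarrow> sat V C R s A \<longleftrightarrow> sat V C R t A"
proof (induction A arbitrary: s t)
  case (Forall i A)
  then have "sat V C R (s(i := v)) A \<longleftrightarrow> sat V C R (t(i := v)) A" for v
    by (intro Forall.IH) auto
  then show ?case by simp
next
  case (Exists i A)
  then have "sat V C R (s(i := v)) A \<longleftrightarrow> sat V C R (t(i := v)) A" for v
    by (intro Exists.IH) auto
  then show ?case by simp
next
  case (Neg A)
  then show ?case by (metis free_vars.simps(4) sat.simps(4))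
next
  case (Conj A B)
  then show ?case by (metis UnCI free_vars.simps(5) sat.simps(5))
qed simp_all


section \<open>Structures on the torus\<close>

text \<open>The binary facts must be given by one rule for all \<open>n\<close> and must not single out a vertex:
  for interpretations chosen freely for each \<open>n\<close>, subject only to the associated graph being the
  torus, there is no zero-one law. (Two predicates may exchange their roles according to the parity
  of \<open>n\<close>; or a loop may mark one vertex, whose colour can be tested.)
  So each predicate \<open>r\<close> has a set \<open>D r\<close> of integer displacements, the same for all \<open>n\<close>, and holds
  of \<open>x, y\<close> iff \<open>y - x\<close> is congruent modulo \<open>n\<close> to an element of \<open>D r\<close>. Examples are
  the adjacency relation itself and the relations \<open>y = x + e\<^sub>i\<close>.\<close>

definition torus_rel ::
  "('r \<Rightarrow> (int ^ 'd::finite) set) \<Rightarrow> nat \<Rightarrow> 'r \<Rightarrow> 'd vertex \<Rightarrow> 'd vertex \<Rightarrow> bool" where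
  "torus_rel D n r x y \<longleftrightarrow> D r \<inter> displacements n x y \<noteq> {}"

definition associated_edges :: "'v set \<Rightarrow> ('r \<Rightarrow> 'v \<Rightarrow> 'v \<Rightarrow> bool) \<Rightarrow> 'v set set" where
  "associated_edges V R = {{x, y} | x y. x \<in> V \<and> y \<in> V \<and> x \<noteq> y \<and> (\<exists>r. R r x y \<or> R r y x)}"

text \<open>By the lemma \<open>sat_cong\<close>, for a sentence the choice of the assignment \<open>s\<close> is immaterial.\<close>

definition models ::
  "('r \<Rightarrow> (int ^ 'd::finite) set) \<Rightarrow> nat \<Rightarrow> ('d vertex \<Rightarrow> real) \<Rightarrow> 'r fm \<Rightarrow> bool" where
  "models D n \<eta> A \<longleftrightarrow>
     (\<forall>s. range s \<subseteq> vertices n \<longrightarrow> sat (vertices n) (\<lambda>x. \<eta> x = 1) (torus_rel D n) s A)"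

definition event ::
  "('r \<Rightarrow> (int ^ 'd::finite) set) \<Rightarrow> nat \<Rightarrow> 'r fm \<Rightarrow> ('d vertex \<Rightarrow> real) set" where
  "event D n A = {\<eta> \<in> configs n. models D n \<eta> A}"

end

theory Submission imports Defs begin

text \<open>
  A pattern with \<open>k\<close> pluses in a fixed cube appears about \<open>e\<^sup>2\<^sup>k\<^sup>a n\<^sup>d\<close> times: bounded degree and bounded pair
  potential change weights by constant factors only. By hypothesis this number tends to \<open>0\<close> or to
  infinity for every \<open>k\<close>. So with probability tending to \<open>1\<close> the numbers \<open>k\<close> of the first kind are not the
  number of pluses of any cube, while every pattern of the second kind occurs far away from any bounded number of points. Between two
  such configurations, even for different \<open>n\<close>, the second player wins the Ehrenfeucht-Fraisse game
  by preserving translates at distances that halve in each round; hence they satisfy the same sentences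
  of bounded complexity.
\<close>

section \<open>Translations of the torus\<close>

text \<open>The interaction destroys independence and, as \<open>b\<close> may have either sign, no
  monotonicity in the configuration is available. The probabilistic estimates therefore compare the
  weight of a configuration with the weight after overwriting a single block. Apart from the field
  factor e^{2a(n)} per plus, this costs at most a factor that depends on the size of the block and
  not on n. This is why only the number of pluses of a pattern, and not its shape, decides whether
  it occurs. The limiting theory need not be described: genericity for one and the same set of
  counts makes any two large configurations equivalent, so a single generic model of the sentence
  decides its truth in all the others. The game can work with bounded radii only if the predicates
  have bounded range, and that has to be extracted from the hypothesis on the associated
  graph.\<close>

definition cube :: "nat \<Rightarrow> (int ^ 'd::finite) set" where
  "cube r = {z. \<forall>i. \<bar>z $ i\<bar> \<le> int r}"

definition translate :: "nat \<Rightarrow> 'd::finite vertex \<Rightarrow> int ^ 'd \<Rightarrow> 'd vertex" where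
  "translate n x z = (\<chi> i. (x $ i + z $ i) mod int n)"

lemma vec_set_eq: "{x :: 'a ^ 'd::finite. \<forall>i. x $ i \<in> S} = vec_lambda ` (UNIV \<rightarrow>\<^sub>E S)"
proof (intro subset_antisym subsetI)
  fix x :: "'a ^ 'd" assume "x \<in> {x. \<forall>i. x $ i \<in> S}"
  then have "vec_nth x \<in> UNIV \<rightarrow>\<^sub>E S" by auto
  then show "x \<in> vec_lambda ` (UNIV \<rightarrow>\<^sub>E S)" by (metis image_eqI vec_nth_inverse)
qed (auto simp: PiE_def Pi_def)

lemma card_vec_set: "card {x :: 'a ^ 'd::finite. \<forall>i. x $ i \<in> S} = card S ^ CARD('d)"
proof -
  have "inj_on vec_lambda (UNIV \<rightarrow>\<^sub>E S :: ('d \<Rightarrow> 'a) set)"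
    by (auto simp: inj_on_def vec_lambda_inject)
  then show ?thesis
    by (simp add: vec_set_eq card_image card_PiE)
qed

lemma finite_cube: "finite (cube r :: (int ^ 'd::finite) set)"
proof -
  have "cube r = {z :: int ^ 'd. \<forall>i. z $ i \<in> {- int r..int r}}"
    by (auto simp: cube_def abs_le_iff minus_le_iff)
  then show ?thesis
    by (simp only: vec_set_eq) (simp add: finite_PiE)
qed

lemma cube_mono: "r \<le> s \<Longrightarrow> cube r \<subseteq> cube s"
  by (fastforce simp: cube_def intro: order_trans[OF _ of_nat_mono])

lemma zero_in_cube: "0 \<in> cube r"
  by (simp add: cube_def)

lemma uminus_in_cube_iff: "- z \<in> cube r \<longleftrightarrow> z \<in> cube r"
  by (simp add: cube_def)

lemma add_in_cube:
  assumes "z \<in> cube r" "w \<in> cube s"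
  shows "z + w \<in> cube (r + s)"
  unfolding cube_def
proof (intro CollectI allI)
  fix i
  have "\<bar>z $ i\<bar> \<le> int r" "\<bar>w $ i\<bar> \<le> int s"
    using assms by (auto simp: cube_def)
  then show "\<bar>(z + w) $ i\<bar> \<le> int (r + s)"
    by simp
qed

lemma translate_in_vertices: "n \<ge> 1 \<Longrightarrow> translate n x z \<in> vertices n"
  by (simp add: translate_def vertices_def)

lemma translate_translate: "translate n (translate n x z) w = translate n x (z + w)"
  by (simp add: translate_def vec_eq_iff mod_simps add.assoc)

lemma translate_zero: "x \<in> vertices n \<Longrightarrow> translate n x 0 = x"
  by (simp add: translate_def vertices_def vec_eq_iff)

lemma translate_eq_iff: "translate n x z = translate n y w \<longleftrightarrow> (\<forall>i. int n dvd (x $ i + z $ i) - (y $ i + w $ i))"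
  by (simp add: translate_def vec_eq_iff mod_eq_dvd_iff)

text \<open>Adjacency and the predicates are defined by congruences; this converts them into
  translates, the form used from here on.\<close>

lemma eq_translate_iff_displacements:
  assumes "y \<in> vertices n"
  shows "y = translate n x z \<longleftrightarrow> z \<in> displacements n x y"
proof -
  have "y = translate n x z \<longleftrightarrow> translate n y 0 = translate n x z"
    using assms by (simp add: translate_zero)
  also have "\<dots> \<longleftrightarrow> (\<forall>i. int n dvd z $ i - (y $ i - x $ i))"
  proof -
    have "int n dvd (y $ i + 0 $ i) - (x $ i + z $ i) \<longleftrightarrow> int n dvd z $ i - (y $ i - x $ i)" for i
      using dvd_minus_iff[of "int n" "z $ i - (y $ i - x $ i)"] by (simp add: algebra_simps)
    then show ?thesis unfolding translate_eq_iff by simp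
  qed
  finally show ?thesis
    by (simp add: displacements_def cong_iff_dvd_diff)
qed

lemma eq_translate_uminus:
  assumes "x \<in> vertices n" "y \<in> vertices n"
  shows "y = translate n x z \<longleftrightarrow> x = translate n y (- z)"
proof
  assume "y = translate n x z"
  then have "translate n y (- z) = translate n x 0"
    by (simp add: translate_translate)
  then show "x = translate n y (- z)"
    using assms by (simp add: translate_zero)
next
  assume "x = translate n y (- z)"
  then have "translate n x z = translate n y 0"
    by (simp add: translate_translate)
  then show "y = translate n x z"
    using assms by (simp add: translate_zero)
qed

lemma int_dvd_small: "int n dvd k \<Longrightarrow> \<bar>k\<bar> < int n \<Longrightarrow> k = 0"
  using dvd_imp_le_int[of k "int n"] by (cases "k = 0") simp_all

text \<open>Two displacements in the cube differ by at most \<open>2 * r\<close> in each coordinate,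
  so below the period \<open>n\<close> a congruence between them is an equality: the cube does not
  overlap itself around the torus.\<close>

lemma inj_on_translate:
  assumes n: "2 * r < n"
  shows "inj_on (translate n x) (cube r)"
proof (rule inj_onI)
  fix z w assume z: "z \<in> cube r" and w: "w \<in> cube r" and eq: "translate n x z = translate n x w"
  have "z $ i - w $ i = 0" for i
  proof (rule int_dvd_small)
    have "int n dvd (x $ i + z $ i) - (x $ i + w $ i)"
      using eq unfolding translate_eq_iff by blast
    then show "int n dvd z $ i - w $ i" by simp
    have "\<bar>z $ i\<bar> \<le> int r" "\<bar>w $ i\<bar> \<le> int r"
      using z w unfolding cube_def by blast+
    moreover have "2 * int r < int n" using n by linarith
    ultimately show "\<bar>z $ i - w $ i\<bar> < int n" by linarith
  qed
  then show "z = w" by (simp add: vec_eq_iff)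
qed

lemma self_eq_translate_iff:
  assumes "x \<in> vertices n" "z \<in> cube r" "2 * r < n"
  shows "x = translate n x z \<longleftrightarrow> z = 0"
  using assms inj_on_translate[of r n x] zero_in_cube[of r] by (metis inj_onD translate_zero)


section \<open>Back-and-forth equivalence of configurations\<close>

text \<open>A position in the game, with \<open>X\<close> the variables already assigned.
  Displacement vectors rather than distances are compared, since predicates may depend on direction;
  the case \<open>z = 0\<close> covers equality. Vertices not within \<open>r\<close> of each other
  on one side must not be so on the other, and nothing more is asked of their relative
  position.\<close>

definition local_eq ::
  "nat \<Rightarrow> nat set \<Rightarrow> nat \<Rightarrow> ('d::finite vertex \<Rightarrow> real) \<Rightarrow> (nat \<Rightarrow> 'd vertex) \<Rightarrow>
    nat \<Rightarrow> ('d vertex \<Rightarrow> real) \<Rightarrow> (nat \<Rightarrow> 'd vertex) \<Rightarrow> bool" where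
  "local_eq r X n \<eta> s n' \<eta>' s' \<longleftrightarrow>
     (\<forall>i\<in>X. s i \<in> vertices n \<and> s' i \<in> vertices n') \<and>
     (\<forall>i\<in>X. \<forall>z\<in>cube r. \<eta> (translate n (s i) z) = 1 \<longleftrightarrow> \<eta>' (translate n' (s' i) z) = 1) \<and>
     (\<forall>i\<in>X. \<forall>j\<in>X. \<forall>z\<in>cube r. s j = translate n (s i) z \<longleftrightarrow> s' j = translate n' (s' i) z)"

lemma local_eq_sym: "local_eq r X n \<eta> s n' \<eta>' s' \<Longrightarrow> local_eq r X n' \<eta>' s' n \<eta> s"
  by (simp add: local_eq_def)

lemma local_eq_mono:
  "local_eq r X n \<eta> s n' \<eta>' s' \<Longrightarrow> r' \<le> r \<Longrightarrow> X' \<subseteq> X \<Longrightarrow> local_eq r' X' n \<eta> s n' \<eta>' s'"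
  unfolding local_eq_def using cube_mono[of r' r] by (meson subsetD)

definition occurs :: "nat \<Rightarrow> (int ^ 'd::finite) set \<Rightarrow> nat \<Rightarrow> ('d vertex \<Rightarrow> real) \<Rightarrow> 'd vertex \<Rightarrow> bool" where
  "occurs r \<pi> n \<eta> x \<longleftrightarrow> (\<forall>z\<in>cube r. \<eta> (translate n x z) = 1 \<longleftrightarrow> z \<in> \<pi>)"

text \<open>\<open>K\<close> is the set of numbers of pluses that a cube may contain.\<close>

definition generic :: "nat set \<Rightarrow> nat \<Rightarrow> nat \<Rightarrow> ('d::finite vertex \<Rightarrow> real) \<Rightarrow> bool" where
  "generic K N n \<eta> \<longleftrightarrow>
     (\<forall>r\<le>N. (\<forall>x\<in>vertices n. card {z \<in> cube r. \<eta> (translate n x z) = 1} \<in> K) \<and>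
       (\<forall>\<pi>\<subseteq>cube r. card \<pi> \<in> K \<longrightarrow>
         (\<forall>F\<subseteq>vertices n. card F \<le> N \<longrightarrow>
           (\<exists>x\<in>vertices n. occurs r \<pi> n \<eta> x \<and> F \<inter> translate n x ` cube r = {}))))"

text \<open>The radius drops from \<open>2 * r\<close> to \<open>r\<close> because the cube of
  radius \<open>r\<close> around a vertex within \<open>r\<close> of an old one stays within
  \<open>2 * r\<close> of the latter. So a nearby move is answered by the same displacement, and any
  other move by a fresh copy of its surroundings.\<close>

lemma local_eq_extend:
  fixes \<eta> \<eta>' :: "'d::finite vertex \<Rightarrow> real"
  assumes eq: "local_eq (2 * r) X n \<eta> s n' \<eta>' s'"
    and gen: "generic K N n \<eta>" "generic K N n' \<eta>'"
    and N: "r \<le> N" "card X \<le> N" and n: "2 * r < n" "2 * r < n'"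
    and X: "finite X" "i \<notin> X" and v: "v \<in> vertices n"
  shows "\<exists>v'\<in>vertices n'. local_eq r (insert i X) n \<eta> (s(i := v)) n' \<eta>' (s'(i := v'))"
proof -
  have V: "s j \<in> vertices n" "s' j \<in> vertices n'" if "j \<in> X" for j
    using eq that by (auto simp: local_eq_def)
  have eq': "local_eq r X n \<eta> s n' \<eta>' s'"
    by (rule local_eq_mono[OF eq]) auto
  \<comment> \<open>It suffices to compare the new vertex with the old ones in one direction:
    negating displacements gives the other direction, and \<open>2 * r < n\<close> settles the new
    vertex against itself.\<close>
  have extend: "local_eq r (insert i X) n \<eta> (s(i := v)) n' \<eta>' (s'(i := v'))"
    if v': "v' \<in> vertices n'"
      and col: "\<And>z. z \<in> cube r \<Longrightarrow> \<eta> (translate n v z) = 1 \<longleftrightarrow> \<eta>' (translate n' v' z) = 1"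
      and dist: "\<And>j z. j \<in> X \<Longrightarrow> z \<in> cube r \<Longrightarrow> s j = translate n v z \<longleftrightarrow> s' j = translate n' v' z" for v'
  proof -
    have dist': "v = translate n (s j) z \<longleftrightarrow> v' = translate n' (s' j) z" if "j \<in> X" "z \<in> cube r" for j z
      using dist[OF that(1), of "- z"] that(2)
      unfolding uminus_in_cube_iff eq_translate_uminus[OF V(1)[OF that(1)] v, of z]
        eq_translate_uminus[OF V(2)[OF that(1)] v', of z] by simp
    have self: "v = translate n v z \<longleftrightarrow> v' = translate n' v' z" if "z \<in> cube r" for z
      unfolding self_eq_translate_iff[OF v that n(1)] self_eq_translate_iff[OF v' that n(2)] ..
    have upd: "(s(i := v)) j = (if j = i then v else s j)" "(s'(i := v')) j = (if j = i then v' else s' j)" for j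
      by simp_all
    have col': "\<eta> (translate n (s j) z) = 1 \<longleftrightarrow> \<eta>' (translate n' (s' j) z) = 1"
      and dist'': "k \<in> X \<Longrightarrow> s k = translate n (s j) z \<longleftrightarrow> s' k = translate n' (s' j) z"
      if "j \<in> X" "z \<in> cube r" for j k z
      using eq' that unfolding local_eq_def by blast+
    show ?thesis
      unfolding local_eq_def upd
    proof (intro conjI ballI)
      fix j and z :: "int ^ 'd" assume "j \<in> insert i X" "z \<in> cube r"
      then show "\<eta> (translate n (if j = i then v else s j) z) = 1 \<longleftrightarrow>
          \<eta>' (translate n' (if j = i then v' else s' j) z) = 1"
        using col col' by (cases "j = i") simp_all
    next
      fix j k and z :: "int ^ 'd" assume "j \<in> insert i X" "k \<in> insert i X" and z: "z \<in> cube r"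
      then consider "j = i" "k = i" | "j = i" "k \<in> X" "k \<noteq> i" | "j \<in> X" "j \<noteq> i" "k = i"
        | "j \<in> X" "j \<noteq> i" "k \<in> X" "k \<noteq> i"
        by blast
      then show "(if k = i then v else s k) = translate n (if j = i then v else s j) z \<longleftrightarrow>
          (if k = i then v' else s' k) = translate n' (if j = i then v' else s' j) z"
        using self[OF z] dist[OF _ z, of k] dist'[OF _ z, of j] dist''[OF _ z, of j k]
        by cases (simp_all only: if_True if_False refl simp_thms)
    qed (use V v v' in auto)
  qed
  show ?thesis
  proof (cases "\<exists>j\<in>X. \<exists>z\<in>cube r. v = translate n (s j) z")
    case True
    then obtain j z where j: "j \<in> X" "z \<in> cube r" "v = translate n (s j) z" by auto
    have zw: "z + w \<in> cube (2 * r)" if "w \<in> cube r" for w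
      using add_in_cube[OF j(2) that] by (simp add: mult_2)
    have "translate n' (s' j) z \<in> vertices n'"
      using n(2) by (intro translate_in_vertices) auto
    moreover have "\<eta> (translate n v w) = 1 \<longleftrightarrow> \<eta>' (translate n' (translate n' (s' j) z) w) = 1" if "w \<in> cube r" for w
      using eq j zw[OF that] by (simp add: local_eq_def translate_translate)
    moreover have "s k = translate n v w \<longleftrightarrow> s' k = translate n' (translate n' (s' j) z) w"
      if "k \<in> X" "w \<in> cube r" for k w
      using eq j that(1) zw[OF that(2)] by (simp add: local_eq_def translate_translate)
    ultimately show ?thesis
      by (intro bexI[of _ "translate n' (s' j) z"] extend)
  next
    case False
    \<comment> \<open>Genericity of the first side puts the number of pluses of this pattern into
      \<open>K\<close>; genericity of the second side then provides a copy away from all old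
      vertices.\<close>
    let ?\<pi> = "{z \<in> cube r. \<eta> (translate n v z) = 1}"
    have "card ?\<pi> \<in> K" "?\<pi> \<subseteq> cube r"
      using gen(1) N(1) v by (auto simp: generic_def)
    moreover have "s' ` X \<subseteq> vertices n'" "card (s' ` X) \<le> N"
      using V card_image_le[OF X(1), of s'] N(2) by auto
    ultimately obtain v' where v': "v' \<in> vertices n'" "occurs r ?\<pi> n' \<eta>' v'"
      "s' ` X \<inter> translate n' v' ` cube r = {}"
      using gen(2) N(1) unfolding generic_def by meson
    \<comment> \<open>Both displacement conditions are false: on the left by the case assumption, on
      the right by the choice of \<open>v'\<close>.\<close>
    have "s k \<noteq> translate n v w" if "k \<in> X" "w \<in> cube r" for k w
      using False that V[OF that(1)] v eq_translate_uminus[of v n "s k" w] uminus_in_cube_iff by metis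
    moreover have "s' k \<noteq> translate n' v' w" if "k \<in> X" "w \<in> cube r" for k w
      using v'(3) that by auto
    ultimately have "local_eq r (insert i X) n \<eta> (s(i := v)) n' \<eta>' (s'(i := v'))"
      using v'(2) by (intro extend v') (auto simp: occurs_def)
    then show ?thesis using v'(1) by blast
  qed
qed

text \<open>Stated for arbitrary \<open>Q\<close> and \<open>Q'\<close> so that the two quantifiers,
  which are separate constructors, share one pair of back-and-forth moves.\<close>

lemma local_eq_quantifiers:
  fixes \<eta> \<eta>' :: "'d::finite vertex \<Rightarrow> real"
  assumes "local_eq (2 * r) X n \<eta> s n' \<eta>' s'"
    and "generic K N n \<eta>" "generic K N n' \<eta>'"
    and "r \<le> N" "card X \<le> N" "2 * r < n" "2 * r < n'" "finite X" "i \<notin> X"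
    and Q: "\<And>v v'. local_eq r (insert i X) n \<eta> (s(i := v)) n' \<eta>' (s'(i := v')) \<Longrightarrow> Q v \<longleftrightarrow> Q' v'"
  shows "(\<forall>v\<in>vertices n. Q v) \<longleftrightarrow> (\<forall>v'\<in>vertices n'. Q' v')"
    and "(\<exists>v\<in>vertices n. Q v) \<longleftrightarrow> (\<exists>v'\<in>vertices n'. Q' v')"
proof -
  have forward: "\<exists>v'\<in>vertices n'. Q v \<longleftrightarrow> Q' v'" if "v \<in> vertices n" for v
    using local_eq_extend[OF assms(1-9) that] Q by blast
  have backward: "\<exists>v\<in>vertices n. Q v \<longleftrightarrow> Q' v'" if "v' \<in> vertices n'" for v'
    using local_eq_extend[OF local_eq_sym[OF assms(1)] assms(3,2,4,5,7,6,8,9) that] Q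
    by (blast dest: local_eq_sym)
  show "(\<forall>v\<in>vertices n. Q v) \<longleftrightarrow> (\<forall>v'\<in>vertices n'. Q' v')"
    and "(\<exists>v\<in>vertices n. Q v) \<longleftrightarrow> (\<exists>v'\<in>vertices n'. Q' v')"
    using forward backward by metis+
qed

section \<open>Transfer of sentences between generic configurations\<close>

text \<open>One crude number that bounds both the quantifier depth, hence the starting radius, and
  the number of free variables, hence the number of vertices that a fresh copy has to avoid.\<close>

primrec complexity :: "'r fm \<Rightarrow> nat" where
  "complexity (Col i) = 1"
| "complexity (Rel r i j) = 2"
| "complexity (Equal i j) = 2"
| "complexity (Neg A) = complexity A"
| "complexity (Conj A B) = complexity A + complexity B"
| "complexity (Forall i A) = Suc (complexity A)"
| "complexity (Exists i A) = Suc (complexity A)"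

lemma finite_free_vars: "finite (free_vars A)"
  by (induction A) auto

lemma card_free_vars_le: "card (free_vars A) \<le> complexity A"
proof (induction A)
  case (Rel r i j)
  then show ?case using card_insert_le_m1[of 2 "{j}" i] by simp
next
  case (Equal i j)
  then show ?case using card_insert_le_m1[of 2 "{j}" i] by simp
next
  case (Conj A B)
  then show ?case using card_Un_le[of "free_vars A" "free_vars B"] by simp
next
  case (Forall i A)
  then show ?case using card_Diff1_le[of "free_vars A" i] by simp
next
  case (Exists i A)
  then show ?case using card_Diff1_le[of "free_vars A" i] by simp
qed simp_all

text \<open>Every quantifier halves the radius up to which the two sides agree.\<close>

lemma sat_local_eq:
  fixes D :: "'r \<Rightarrow> (int ^ 'd::finite) set"
  assumes D: "\<And>r. D r \<subseteq> cube c" and gen: "generic K N n \<eta>" "generic K N n' \<eta>'"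
    and N: "2 * N < n" "2 * N < n'"
  shows "local_eq (2 ^ complexity A * c) (free_vars A) n \<eta> s n' \<eta>' s' \<Longrightarrow>
    complexity A \<le> N \<Longrightarrow> 2 ^ complexity A * c \<le> N \<Longrightarrow>
    sat (vertices n) (\<lambda>x. \<eta> x = 1) (torus_rel D n) s A \<longleftrightarrow>
    sat (vertices n') (\<lambda>x. \<eta>' x = 1) (torus_rel D n') s' A"
proof (induction A arbitrary: s s')
  case (Col i)
  then show ?case
    using zero_in_cube by (force simp: local_eq_def translate_zero)
next
  case (Rel r i j)
  have V: "s j \<in> vertices n" "s' j \<in> vertices n'"
    using Rel by (auto simp: local_eq_def)
  have "s j = translate n (s i) z \<longleftrightarrow> s' j = translate n' (s' i) z" if "z \<in> D r" for z
  proof -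
    \<comment> \<open>The radius left at an atom is still at least \<open>c\<close>, the range of
      the predicates.\<close>
    have "z \<in> cube (2 ^ complexity (Rel r i j) * c)"
      using D[of r] that cube_mono[of c "4 * c"] by auto
    then show ?thesis using Rel(1) by (simp add: local_eq_def)
  qed
  then show ?case
    using V by (auto simp: torus_rel_def eq_translate_iff_displacements)
next
  case (Equal i j)
  have "s i \<in> vertices n" "s' i \<in> vertices n'"
    using Equal by (auto simp: local_eq_def)
  moreover have "s j = translate n (s i) 0 \<longleftrightarrow> s' j = translate n' (s' i) 0"
    using Equal(1) by (simp add: local_eq_def zero_in_cube)
  ultimately show ?case by (simp add: translate_zero eq_commute[of "s i"] eq_commute[of "s' i"])
next
  case (Neg A)
  show ?case using Neg.IH[of s s'] Neg.prems by simp
next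
  case (Conj A B)
  let ?c = "\<lambda>A. 2 ^ complexity A * c"
  have "?c A \<le> ?c (Conj A B)" "?c B \<le> ?c (Conj A B)"
    by (auto intro!: mult_right_mono power_increasing)
  note le = order_trans[OF this(1) Conj.prems(3)] order_trans[OF this(2) Conj.prems(3)]
    local_eq_mono[OF Conj.prems(1) this(1)] local_eq_mono[OF Conj.prems(1) this(2)]
  have "complexity A \<le> N" "complexity B \<le> N"
    using Conj.prems(2) by simp_all
  then show ?case
    using Conj.IH[of s s'] le by simp
next
  case (Forall i A)
  \<comment> \<open>The old value of \<open>i\<close> is forgotten before the move, so that the new
    one can be inserted.\<close>
  let ?r = "2 ^ complexity A * c" and ?X = "free_vars A - {i}"
  have r: "?r \<le> N" "2 * ?r < n" "2 * ?r < n'" and X: "finite ?X" "i \<notin> ?X" "card ?X \<le> N"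
    using Forall.prems N finite_free_vars[of A] card_free_vars_le[of "Forall i A"] by auto
  have eq: "local_eq (2 * ?r) ?X n \<eta> s n' \<eta>' s'"
    using Forall.prems(1) by (simp add: mult.assoc)
  have IH: "sat (vertices n) (\<lambda>x. \<eta> x = 1) (torus_rel D n) (s(i := v)) A \<longleftrightarrow>
    sat (vertices n') (\<lambda>x. \<eta>' x = 1) (torus_rel D n') (s'(i := v')) A"
    if "local_eq ?r (insert i ?X) n \<eta> (s(i := v)) n' \<eta>' (s'(i := v'))" for v v'
    using Forall.prems r(1) by (intro Forall.IH local_eq_mono[OF that]) auto
  show ?case
    unfolding sat.simps
    by (rule local_eq_quantifiers(1)[OF eq gen r(1) X(3) r(2,3) X(1,2)]) (rule IH)
next
  case (Exists i A)
  let ?r = "2 ^ complexity A * c" and ?X = "free_vars A - {i}"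
  have r: "?r \<le> N" "2 * ?r < n" "2 * ?r < n'" and X: "finite ?X" "i \<notin> ?X" "card ?X \<le> N"
    using Exists.prems N finite_free_vars[of A] card_free_vars_le[of "Exists i A"] by auto
  have eq: "local_eq (2 * ?r) ?X n \<eta> s n' \<eta>' s'"
    using Exists.prems(1) by (simp add: mult.assoc)
  have IH: "sat (vertices n) (\<lambda>x. \<eta> x = 1) (torus_rel D n) (s(i := v)) A \<longleftrightarrow>
    sat (vertices n') (\<lambda>x. \<eta>' x = 1) (torus_rel D n') (s'(i := v')) A"
    if "local_eq ?r (insert i ?X) n \<eta> (s(i := v)) n' \<eta>' (s'(i := v'))" for v v'
    using Exists.prems r(1) by (intro Exists.IH local_eq_mono[OF that]) auto
  show ?case
    unfolding sat.simps
    by (rule local_eq_quantifiers(2)[OF eq gen r(1) X(3) r(2,3) X(1,2)]) (rule IH)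
qed

text \<open>A sentence starts the game with no assigned variables, so \<open>local_eq\<close> holds
  vacuously even between tori of different sizes.\<close>

lemma models_generic_cong:
  fixes D :: "'r \<Rightarrow> (int ^ 'd::finite) set"
  assumes "\<And>r. D r \<subseteq> cube c" "generic K N n \<eta>" "generic K N n' \<eta>'" "2 * N < n" "2 * N < n'"
    and "sentence A" "complexity A \<le> N" "2 ^ complexity A * c \<le> N"
  shows "models D n \<eta> A \<longleftrightarrow> models D n' \<eta>' A"
proof -
  have eq: "sat (vertices n) (\<lambda>x. \<eta> x = 1) (torus_rel D n) s A \<longleftrightarrow>
    sat (vertices n') (\<lambda>x. \<eta>' x = 1) (torus_rel D n') s' A" for s s'
    using assms by (intro sat_local_eq[where c = c and K = K and N = N])
      (auto simp: local_eq_def sentence_def)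
  \<comment> \<open>\<open>models\<close> quantifies over assignments; these constant ones show that
    the quantification is not vacuous.\<close>
  have "range (\<lambda>_. translate n 0 0) \<subseteq> vertices n" "range (\<lambda>_. translate n' 0 0) \<subseteq> vertices n'"
    using assms(4,5) by (auto intro: translate_in_vertices)
  note range = this
  show ?thesis
    unfolding models_def
  proof (intro iffI allI impI)
    fix s' assume "\<forall>s. range s \<subseteq> vertices n \<longrightarrow> sat (vertices n) (\<lambda>x. \<eta> x = 1) (torus_rel D n) s A"
    from mp[OF spec[OF this] range(1)] have "sat (vertices n) (\<lambda>x. \<eta> x = 1) (torus_rel D n) (\<lambda>_. translate n 0 0) A" .
    then show "sat (vertices n') (\<lambda>x. \<eta>' x = 1) (torus_rel D n') s' A"
      by (simp only: eq[of "\<lambda>_. translate n 0 0" s'])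
  next
    fix s assume "\<forall>s. range s \<subseteq> vertices n' \<longrightarrow> sat (vertices n') (\<lambda>x. \<eta>' x = 1) (torus_rel D n') s A"
    from mp[OF spec[OF this] range(2)] have "sat (vertices n') (\<lambda>x. \<eta>' x = 1) (torus_rel D n') (\<lambda>_. translate n' 0 0) A" .
    then show "sat (vertices n) (\<lambda>x. \<eta> x = 1) (torus_rel D n) s A"
      by (simp only: eq[of s "\<lambda>_. translate n' 0 0"])
  qed
qed


section \<open>Bounds on the Ising measure\<close>

lemma card_vertices: "card (vertices n :: 'd::finite vertex set) = n ^ CARD('d)"
proof -
  have "vertices n = {x :: 'd vertex. \<forall>i. x $ i \<in> {0..<int n}}"
    by (auto simp: vertices_def)
  then show ?thesis by (simp only: card_vec_set card_atLeastLessThan_int) simp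
qed

text \<open>An L_p ball lies in the sup-norm ball of the same radius, hence in a cube; this bounds
  the degrees of the torus graphs uniformly in \<open>n\<close>.\<close>

lemma lp_norm_component_le:
  assumes "1 \<le> p"
  shows "\<bar>x $ i\<bar> \<le> lp_norm p x"
proof (cases "p = \<infinity>")
  case True
  then show ?thesis by (simp add: lp_norm_def component_le_infnorm_cart)
next
  case False
  define q where "q = real_of_ereal p"
  have q: "1 \<le> q" using assms False by (cases p) (auto simp: q_def)
  have "\<bar>x $ i\<bar> powr q \<le> (\<Sum>i\<in>UNIV. \<bar>x $ i\<bar> powr q)"
    by (rule member_le_sum) auto
  then have "(\<bar>x $ i\<bar> powr q) powr (1 / q) \<le> (\<Sum>i\<in>UNIV. \<bar>x $ i\<bar> powr q) powr (1 / q)"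
    using q by (intro powr_mono2) auto
  then show ?thesis
    using q False by (simp add: lp_norm_def powr_powr flip: q_def)
qed

lemma torus_adj_translate:
  assumes "1 \<le> p" "\<rho> \<le> real c" "y \<in> vertices n" "torus_adj p \<rho> n x y"
  obtains z where "z \<in> cube c" "y = translate n x z"
proof -
  obtain z where z: "z \<in> displacements n x y" "lp_norm p (\<chi> i. real_of_int (z $ i)) \<le> \<rho>"
    using assms(4) by (auto simp: torus_adj_def)
  have "\<bar>z $ i\<bar> \<le> int c" for i
  proof -
    have "real_of_int \<bar>z $ i\<bar> \<le> real c"
      using lp_norm_component_le[OF assms(1), of "\<chi> i. real_of_int (z $ i)" i] z(2) assms(2) by simp
    then show ?thesis by linarith
  qed
  then have "z \<in> cube c" by (simp add: cube_def)
  moreover have "y = translate n x z"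
    using z(1) eq_translate_iff_displacements[OF assms(3)] by simp
  ultimately show ?thesis by (rule that)
qed

section \<open>Overwriting a configuration on a block\<close>

definition matches :: "'v set \<Rightarrow> 'v set \<Rightarrow> ('v \<Rightarrow> real) \<Rightarrow> bool" where
  "matches Q B \<eta> \<longleftrightarrow> (\<forall>y\<in>B. \<eta> y = 1 \<longleftrightarrow> y \<in> Q)"

text \<open>A surrogate for conditioning on the configuration outside \<open>B\<close>: a map on
  configurations that changes the weight by a controlled factor.\<close>

definition plant :: "'v set \<Rightarrow> 'v set \<Rightarrow> ('v \<Rightarrow> real) \<Rightarrow> 'v \<Rightarrow> real" where
  "plant Q B \<eta> y = (if y \<in> B then if y \<in> Q then 1 else - 1 else \<eta> y)"

lemma plant_in_configs:
  fixes \<eta> :: "'d::finite vertex \<Rightarrow> real"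
  shows "\<eta> \<in> configs n \<Longrightarrow> B \<subseteq> vertices n \<Longrightarrow> plant Q B \<eta> \<in> configs n"
  by (auto simp: configs_def plant_def PiE_def Pi_def extensional_def)

lemma matches_plant: "matches Q B (plant Q B \<eta>)"
  by (simp add: matches_def plant_def)

lemma matches_plant_disjoint:
  "B \<inter> B' = {} \<Longrightarrow> matches Q' B' (plant Q B \<eta>) \<longleftrightarrow> matches Q' B' \<eta>"
  unfolding matches_def plant_def by (intro ball_cong) auto

lemma plant_outside: "y \<notin> B \<Longrightarrow> plant Q B \<eta> y = \<eta> y"
  by (simp add: plant_def)

text \<open>The erased values are recovered from their set of pluses, so planting merges at most
  \<open>2 ^ card B\<close> configurations when \<open>B\<close> is finite.\<close>

lemma inj_on_plant:
  fixes B :: "'d::finite vertex set"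
  shows "inj_on (\<lambda>\<eta>. ({y \<in> B. \<eta> y = 1}, plant Q B \<eta>)) (configs n)"
proof (rule inj_onI)
  fix \<eta> \<xi> :: "'d vertex \<Rightarrow> real"
  assume in_c: "\<eta> \<in> configs n" "\<xi> \<in> configs n"
    and eq: "({y \<in> B. \<eta> y = 1}, plant Q B \<eta>) = ({y \<in> B. \<xi> y = 1}, plant Q B \<xi>)"
  show "\<eta> = \<xi>"
  proof
    fix y
    show "\<eta> y = \<xi> y"
    proof (cases "y \<in> B")
      case True
      then have "\<eta> y = 1 \<longleftrightarrow> \<xi> y = 1" using eq by blast
      \<comment> \<open>\<open>B\<close> is arbitrary here; at a point off the torus both
        configurations take the default value \<open>undefined\<close>.\<close>
      moreover have "\<eta> y \<in> {-1, 1} \<and> \<xi> y \<in> {-1, 1} \<or> \<eta> y = undefined \<and> \<xi> y = undefined"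
        using in_c by (cases "y \<in> vertices n") (auto simp: configs_def PiE_def Pi_def extensional_def)
      ultimately show ?thesis by auto
    next
      case False
      have "plant Q B \<eta> y = plant Q B \<xi> y" using eq by simp
      then show ?thesis using False by (simp add: plant_def)
    qed
  qed
qed

lemma sum_config:
  fixes \<eta> :: "'d::finite vertex \<Rightarrow> real"
  assumes "\<eta> \<in> configs n" "S \<subseteq> vertices n"
  shows "(\<Sum>x\<in>S. \<eta> x) = 2 * real (card {x \<in> S. \<eta> x = 1}) - real (card S)"
proof -
  have S: "finite S" using assms(2) finite_vertices finite_subset by blast
  have "\<eta> x = 2 * of_bool (\<eta> x = 1) - 1" if "x \<in> S" for x
    using assms that by (auto simp: configs_def)
  then have "(\<Sum>x\<in>S. \<eta> x) = (\<Sum>x\<in>S. 2 * of_bool (\<eta> x = 1) - 1)"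
    by (intro sum.cong) auto
  also have "\<dots> = 2 * (\<Sum>x\<in>S. of_bool (\<eta> x = 1)) - real (card S)"
    by (simp add: sum_subtractf sum_distrib_left)
  also have "(\<Sum>x\<in>S. of_bool (\<eta> x = 1)) = real (card {x \<in> S. \<eta> x = 1})"
    using S by (simp add: of_bool_def sum.If_cases Int_def)
  finally show ?thesis by simp
qed

section \<open>Weights and probabilities at a fixed size\<close>

text \<open>\<open>b\<close> bounds the pair potential and \<open>c\<close> the range of the edges.
  Later \<open>ising_sequence\<close> supplies the same two constants for every size, which makes
  the resulting bounds uniform.\<close>

locale bounded_ising =
  fixes p :: ereal and \<rho> \<alpha> \<beta> b :: real and c n :: nat
  assumes p: "1 \<le> p" and \<rho>: "\<rho> \<le> real c" and \<alpha>: "\<alpha> \<le> 0" and \<beta>: "\<bar>\<beta>\<bar> \<le> b" and n: "1 \<le> n"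
begin

abbreviation w :: "('d::finite vertex \<Rightarrow> real) \<Rightarrow> real" where
  "w \<equiv> ising_weight p \<rho> \<alpha> \<beta> n"

abbreviation P :: "('d::finite vertex \<Rightarrow> real) set \<Rightarrow> real" where
  "P \<equiv> measure (ising p \<rho> \<alpha> \<beta> n)"

lemma w_pos: "w \<eta> > 0"
  by (simp add: ising_weight_def)

lemma Z_pos: "(\<Sum>\<xi>\<in>configs n. w \<xi>) > 0"
  by (intro sum_pos finite_configs configs_nonempty w_pos)

lemma measure_ising:
  fixes E :: "('d::finite vertex \<Rightarrow> real) set"
  assumes "E \<subseteq> configs n"
  shows "P E = (\<Sum>\<eta>\<in>E. w \<eta>) / (\<Sum>\<xi>\<in>configs n. w (\<xi> :: 'd vertex \<Rightarrow> real))"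
proof -
  let ?Z = "\<Sum>\<xi>\<in>configs n. w (\<xi> :: 'd vertex \<Rightarrow> real)"
  have "0 \<le> 1 / ?Z * w \<eta>" for \<eta> :: "'d vertex \<Rightarrow> real"
    using Z_pos[where 'a = 'd] w_pos[of \<eta>] by simp
  then show ?thesis
    using assms unfolding ising_def Let_def
    by (subst measure_point_measure_finite_if) (simp_all add: finite_configs sum_divide_distrib)
qed

lemma measure_ising_subadditive:
  fixes E :: "'i \<Rightarrow> ('d::finite vertex \<Rightarrow> real) set"
  assumes "finite I" "\<And>i. i \<in> I \<Longrightarrow> E i \<subseteq> configs n"
  shows "P (\<Union>i\<in>I. E i) \<le> (\<Sum>i\<in>I. P (E i))"
proof -
  interpret prob_space "ising p \<rho> \<alpha> \<beta> n :: ('d vertex \<Rightarrow> real) measure"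
    by (rule prob_space_ising)
  show ?thesis
    using assms by (intro finite_measure_subadditive_finite)
      (auto simp: ising_def Let_def sets_point_measure)
qed

lemma measure_ising_Un_le:
  fixes E E' :: "('d::finite vertex \<Rightarrow> real) set"
  assumes "E \<subseteq> configs n" "E' \<subseteq> configs n"
  shows "P (E \<union> E') \<le> P E + P E'"
proof -
  interpret prob_space "ising p \<rho> \<alpha> \<beta> n :: ('d vertex \<Rightarrow> real) measure"
    by (rule prob_space_ising)
  show ?thesis
    using assms by (intro measure_Un_le)
      (auto simp: ising_def Let_def sets_point_measure)
qed

lemma measure_ising_mono:
  fixes E E' :: "('d::finite vertex \<Rightarrow> real) set"
  assumes "E \<subseteq> E'" "E' \<subseteq> configs n"
  shows "P E \<le> P E'"
proof -
  interpret prob_space "ising p \<rho> \<alpha> \<beta> n :: ('d vertex \<Rightarrow> real) measure"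
    by (rule prob_space_ising)
  show ?thesis
    using assms by (intro finite_measure_mono) (auto simp: ising_def Let_def sets_point_measure)
qed

lemma card_touching_edges:
  fixes S :: "'d::finite vertex set"
  assumes "finite S"
  shows "card {e \<in> torus_edges p \<rho> n. e \<inter> S \<noteq> {}} \<le> card S * card (cube c :: (int ^ 'd) set)"
proof -
  have "{e \<in> torus_edges p \<rho> n. e \<inter> S \<noteq> {}} \<subseteq> (\<lambda>(x, z). {x, translate n x z}) ` (S \<times> cube c)"
  proof
    fix e assume "e \<in> {e \<in> torus_edges p \<rho> n. e \<inter> S \<noteq> {}}"
    then obtain x y where e: "e = {x, y}" "x \<in> S" "y \<in> vertices n" "torus_adj p \<rho> n x y"
      by (auto simp: torus_edges_def dest: torus_adj_sym)
    obtain z where "z \<in> cube c" "y = translate n x z"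
      by (rule torus_adj_translate[OF p \<rho> e(3,4)])
    then show "e \<in> (\<lambda>(x, z). {x, translate n x z}) ` (S \<times> cube c)"
      using e by auto
  qed
  then have "card {e \<in> torus_edges p \<rho> n. e \<inter> S \<noteq> {}}
      \<le> card ((\<lambda>(x, z). {x, translate n x z}) ` (S \<times> (cube c :: (int ^ 'd) set)))"
    using assms by (intro card_mono finite_imageI finite_cartesian_product finite_cube)
  also have "\<dots> \<le> card (S \<times> (cube c :: (int ^ 'd) set))"
    using assms by (intro card_image_le finite_cartesian_product finite_cube)
  finally show ?thesis by (simp add: card_cartesian_product)
qed

lemma finite_torus_edges: "finite (torus_edges p \<rho> n :: 'd::finite vertex set set)"
  by (rule finite_subset[of _ "Pow (vertices n)"]) (auto simp: torus_edges_def finite_vertices)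

text \<open>Only terms that meet \<open>S\<close> change. Each extra plus shifts the field exponent
  by \<open>2 * \<alpha>\<close>, since a spin jumps by 2; each of the at most
  \<open>card S * card (cube c)\<close> edges touching \<open>S\<close> moves its product by at most
  2, whence the first exponential.\<close>

lemma weight_ratio:
  fixes \<eta> \<eta>' :: "'d::finite vertex \<Rightarrow> real"
  assumes in_c: "\<eta> \<in> configs n" "\<eta>' \<in> configs n" and S: "S \<subseteq> vertices n"
    and agree: "\<And>x. x \<notin> S \<Longrightarrow> \<eta> x = \<eta>' x"
  shows "w \<eta> \<le> exp (2 * b * real (card S * card (cube c :: (int ^ 'd) set)))
      * exp (2 * \<alpha> * (real (card {x \<in> S. \<eta> x = 1}) - real (card {x \<in> S. \<eta>' x = 1}))) * w \<eta>'"
proof -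
  let ?E = "torus_edges p \<rho> n :: 'd vertex set set"
  let ?T = "{e \<in> ?E. e \<inter> S \<noteq> {}}"
  let ?k = "real (card S * card (cube c :: (int ^ 'd) set))"
  have finS: "finite S" using S finite_vertices finite_subset by blast
  have b: "b \<ge> 0" using \<beta> by linarith
  have "(\<Sum>x\<in>vertices n. \<eta> x) - (\<Sum>x\<in>vertices n. \<eta>' x) = (\<Sum>x\<in>vertices n. \<eta> x - \<eta>' x)"
    by (simp add: sum_subtractf)
  also have "\<dots> = (\<Sum>x\<in>S. \<eta> x - \<eta>' x)"
    using S agree by (intro sum.mono_neutral_right finite_vertices) auto
  also have "\<dots> = 2 * (real (card {x \<in> S. \<eta> x = 1}) - real (card {x \<in> S. \<eta>' x = 1}))"
    using in_c S by (simp add: sum_subtractf sum_config)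
  finally have field: "(\<Sum>x\<in>vertices n. \<eta> x) = (\<Sum>x\<in>vertices n. \<eta>' x) +
      2 * (real (card {x \<in> S. \<eta> x = 1}) - real (card {x \<in> S. \<eta>' x = 1}))" by simp
  have abs_prod: "\<bar>\<Prod>x\<in>e. \<xi> x\<bar> = 1" if "e \<in> ?E" "\<xi> \<in> configs n" for e \<xi>
    unfolding abs_prod using that by (intro prod.neutral) (auto simp: torus_edges_def configs_def PiE_def Pi_def)
  have "(\<Sum>e\<in>?E. \<Prod>x\<in>e. \<eta> x) - (\<Sum>e\<in>?E. \<Prod>x\<in>e. \<eta>' x)
      = (\<Sum>e\<in>?E. (\<Prod>x\<in>e. \<eta> x) - (\<Prod>x\<in>e. \<eta>' x))"
    by (simp add: sum_subtractf)
  also have "\<dots> = (\<Sum>e\<in>?T. (\<Prod>x\<in>e. \<eta> x) - (\<Prod>x\<in>e. \<eta>' x))"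
    using agree by (intro sum.mono_neutral_right finite_torus_edges) (auto intro!: prod.cong)
  finally have "\<bar>(\<Sum>e\<in>?E. \<Prod>x\<in>e. \<eta> x) - (\<Sum>e\<in>?E. \<Prod>x\<in>e. \<eta>' x)\<bar>
      \<le> (\<Sum>e\<in>?T. \<bar>(\<Prod>x\<in>e. \<eta> x) - (\<Prod>x\<in>e. \<eta>' x)\<bar>)" by (simp only: sum_abs)
  also have "\<dots> \<le> (\<Sum>e\<in>?T. 2)"
  proof (rule sum_mono)
    fix e assume "e \<in> ?T"
    then show "\<bar>(\<Prod>x\<in>e. \<eta> x) - (\<Prod>x\<in>e. \<eta>' x)\<bar> \<le> 2"
      using abs_prod[of e \<eta>] abs_prod[of e \<eta>'] in_c by auto
  qed
  also have "\<dots> \<le> 2 * ?k"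
    using card_touching_edges[OF finS] by (simp flip: of_nat_mult)
  finally have "\<bar>(\<Sum>e\<in>?E. \<Prod>x\<in>e. \<eta> x) - (\<Sum>e\<in>?E. \<Prod>x\<in>e. \<eta>' x)\<bar> \<le> 2 * ?k" .
  then have "\<bar>\<beta>\<bar> * \<bar>(\<Sum>e\<in>?E. \<Prod>x\<in>e. \<eta> x) - (\<Sum>e\<in>?E. \<Prod>x\<in>e. \<eta>' x)\<bar> \<le> b * (2 * ?k)"
    using \<beta> b by (intro mult_mono) auto
  then have pair: "\<beta> * ((\<Sum>e\<in>?E. \<Prod>x\<in>e. \<eta> x) - (\<Sum>e\<in>?E. \<Prod>x\<in>e. \<eta>' x)) \<le> 2 * b * ?k"
    unfolding abs_mult[symmetric] by linarith
  show ?thesis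
    unfolding ising_weight_def field exp_add[symmetric] exp_le_cancel_iff
    using pair by (simp add: algebra_simps)
qed

text \<open>Turning \<open>S\<close> to minus is injective on this event, as the erased values are
  known, so the images together weigh at most the partition function. Each image has
  \<open>card S\<close> fewer pluses, and \<open>weight_ratio\<close> gives the price.\<close>

lemma measure_all_plus_le:
  fixes S :: "'d::finite vertex set"
  assumes S: "S \<subseteq> vertices n"
  shows "P {\<eta> \<in> configs n. \<forall>x\<in>S. \<eta> x = 1}
    \<le> exp (2 * b * real (card S * card (cube c :: (int ^ 'd) set))) * exp (2 * \<alpha> * real (card S))"
proof -
  let ?E = "{\<eta> \<in> configs n. \<forall>x\<in>S. \<eta> x = 1}"
  let ?K = "exp (2 * b * real (card S * card (cube c :: (int ^ 'd) set))) * exp (2 * \<alpha> * real (card S))"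
  have "inj_on (plant {} S) ?E"
  proof (rule inj_onI)
    fix \<eta> \<xi> assume E: "\<eta> \<in> ?E" "\<xi> \<in> ?E" and eq: "plant {} S \<eta> = plant {} S \<xi>"
    then have "{y \<in> S. \<eta> y = 1} = {y \<in> S. \<xi> y = 1}" by auto
    then show "\<eta> = \<xi>"
      using inj_onD[OF inj_on_plant, of S \<eta> "{}" \<xi> n] E eq by auto
  qed
  then have "(\<Sum>\<eta>\<in>?E. w (plant {} S \<eta>)) = (\<Sum>\<eta>\<in>plant {} S ` ?E. w \<eta>)"
    by (simp add: sum.reindex)
  also have "\<dots> \<le> (\<Sum>\<eta>\<in>configs n. w (\<eta> :: 'd vertex \<Rightarrow> real))"
  proof (rule sum_mono2[OF finite_configs])
    show "plant {} S ` ?E \<subseteq> configs n"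
      using S by (auto intro: plant_in_configs)
  qed (simp add: less_imp_le[OF w_pos])
  finally have Z: "(\<Sum>\<eta>\<in>?E. w (plant {} S \<eta>)) \<le> (\<Sum>\<eta>\<in>configs n. w (\<eta> :: 'd vertex \<Rightarrow> real))" .
  have "(\<Sum>\<eta>\<in>?E. w \<eta>) \<le> (\<Sum>\<eta>\<in>?E. ?K * w (plant {} S \<eta>))"
  proof (rule sum_mono)
    fix \<eta> assume \<eta>: "\<eta> \<in> ?E"
    have plus: "{x \<in> S. \<eta> x = 1} = S" "{x \<in> S. plant {} S \<eta> x = 1} = {}"
      using \<eta> by (auto simp: plant_def)
    have "\<eta> \<in> configs n" "plant {} S \<eta> \<in> configs n"
      using \<eta> S by (auto intro: plant_in_configs)
    from weight_ratio[OF this S, unfolded plus] show "w \<eta> \<le> ?K * w (plant {} S \<eta>)"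
      by (simp add: plant_outside)
  qed
  also have "\<dots> \<le> ?K * (\<Sum>\<eta>\<in>configs n. w (\<eta> :: 'd vertex \<Rightarrow> real))"
    unfolding sum_distrib_left[symmetric] by (intro mult_left_mono Z) simp
  finally show ?thesis
    using Z_pos[where 'a = 'd] by (simp add: measure_ising pos_divide_le_eq)
qed

text \<open>A lower bound for the probability that a given pattern with \<open>k\<close> pluses occupies a given set of
  \<open>m\<close> vertices, whatever happens outside: the factor \<open>2 ^ m\<close> counts the configurations that planting
  the pattern identifies.\<close>

definition success :: "'d::finite itself \<Rightarrow> nat \<Rightarrow> nat \<Rightarrow> real" where
  "success _ m k = exp (2 * \<alpha> * real k)
     / (2 ^ m * exp (2 * b * real (m * card (cube c :: (int ^ 'd) set))))"

lemma success_pos: "success d m k > 0"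
  by (simp add: success_def)

lemma success_le_1: "success (d :: 'd::finite itself) m k \<le> 1"
proof -
  have "b \<ge> 0" using \<beta> by linarith
  then have "1 * 1 \<le> 2 ^ m * exp (2 * b * real (m * card (cube c :: (int ^ 'd) set)))"
    by (intro mult_mono) auto
  moreover have "exp (2 * \<alpha> * real k) \<le> 1"
    using \<alpha> by (simp add: mult_nonpos_nonneg)
  ultimately have "exp (2 * \<alpha> * real k) \<le> 2 ^ m * exp (2 * b * real (m * card (cube c :: (int ^ 'd) set)))"
    by linarith
  then show ?thesis
    by (simp add: success_def divide_le_eq_1)
qed

text \<open>The assumption \<open>closed\<close> stands in for independence of \<open>F\<close> from
  the block: it keeps the planted configurations inside \<open>F\<close>, so the weight of
  \<open>F\<close> can be charged to its matching part.\<close>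

lemma measure_matches_ge:
  fixes B :: "'d::finite vertex set"
  assumes B: "B \<subseteq> vertices n" "Q \<subseteq> B" and F: "F \<subseteq> configs n"
    and closed: "\<And>\<eta>. \<eta> \<in> F \<Longrightarrow> plant Q B \<eta> \<in> F"
  shows "success TYPE('d) (card B) (card Q) * P F \<le> P {\<eta> \<in> F. matches Q B \<eta>}"
proof -
  let ?E = "{\<eta> \<in> F. matches Q B \<eta>}"
  let ?K = "exp (2 * b * real (card B * card (cube c :: (int ^ 'd) set))) * exp (2 * \<alpha> * - real (card Q))"
  have finB: "finite B" and finF: "finite F"
    using B F finite_vertices finite_configs finite_subset by blast+
  have "(\<Sum>\<eta>\<in>F. w \<eta>) \<le> (\<Sum>\<eta>\<in>F. ?K * w (plant Q B \<eta>))"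
  proof (rule sum_mono)
    fix \<eta> assume "\<eta> \<in> F"
    then have \<eta>: "\<eta> \<in> configs n" using F by auto
    have "{x \<in> B. plant Q B \<eta> x = 1} = Q"
      using B by (auto simp: plant_def)
    then have "w \<eta> \<le> exp (2 * b * real (card B * card (cube c :: (int ^ 'd) set)))
      * exp (2 * \<alpha> * (real (card {x \<in> B. \<eta> x = 1}) - real (card Q))) * w (plant Q B \<eta>)"
      using weight_ratio[of \<eta> "plant Q B \<eta>" B] \<eta> B by (simp add: plant_in_configs plant_outside)
    \<comment> \<open>As \<open>\<alpha> \<le> 0\<close>, the worst case is a block that had no
      pluses before planting.\<close>
    also have "\<dots> \<le> ?K * w (plant Q B \<eta>)"
      using \<alpha> less_imp_le[OF w_pos, of "plant Q B \<eta>"]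
      by (intro mult_right_mono mult_left_mono)
        (auto simp: mult_nonpos_nonneg right_diff_distrib)
    finally show "w \<eta> \<le> ?K * w (plant Q B \<eta>)" .
  qed
  also have "\<dots> = ?K * (\<Sum>\<eta>\<in>F. w (plant Q B \<eta>))"
    by (simp add: sum_distrib_left)
  \<comment> \<open>Recording the erased pluses \<open>T\<close> makes the reindexing injective;
    letting \<open>T\<close> range over all subsets of \<open>B\<close> produces the power of
    2.\<close>
  also have "(\<Sum>\<eta>\<in>F. w (plant Q B \<eta>)) = (\<Sum>(T, \<xi>)\<in>(\<lambda>\<eta>. ({y \<in> B. \<eta> y = 1}, plant Q B \<eta>)) ` F. w \<xi>)"
    by (subst sum.reindex) (auto intro: inj_on_subset[OF inj_on_plant F])
  also have "\<dots> \<le> (\<Sum>(T, \<xi>)\<in>Pow B \<times> ?E. w \<xi>)"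
    using finB finF closed
    by (intro sum_mono2) (auto intro: less_imp_le[OF w_pos] matches_plant)
  also have "\<dots> = 2 ^ card B * (\<Sum>\<xi>\<in>?E. w \<xi>)"
    using finB by (simp add: sum.cartesian_product[symmetric] card_Pow)
  finally have "(\<Sum>\<eta>\<in>F. w \<eta>) \<le> ?K * (2 ^ card B * (\<Sum>\<xi>\<in>?E. w \<xi>))" by simp
  then have "success TYPE('d) (card B) (card Q) * (\<Sum>\<eta>\<in>F. w \<eta>) \<le> (\<Sum>\<xi>\<in>?E. w \<xi>)"
    by (simp add: success_def exp_minus field_simps)
  moreover have "?E \<subseteq> configs n" using F by auto
  ultimately show ?thesis
    using divide_right_mono[OF _ less_imp_le[OF Z_pos[where 'a = 'd]], of "success TYPE('d) (card B) (card Q) * (\<Sum>\<eta>\<in>F. w \<eta>)"]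
    by (simp add: measure_ising[OF F] measure_ising)
qed

text \<open>No independence is needed: planting a pattern in one set does not affect the event that the
  patterns are absent from the sets disjoint from it.\<close>

lemma measure_no_match_le:
  fixes B :: "'g \<Rightarrow> 'd::finite vertex set"
  assumes "finite G" and "\<And>g. g \<in> G \<Longrightarrow> B g \<subseteq> vertices n \<and> Q g \<subseteq> B g \<and> card (B g) = m \<and> card (Q g) = k"
    and "disjoint_family_on B G"
  shows "P {\<eta> \<in> configs n. \<forall>g\<in>G. \<not> matches (Q g) (B g) \<eta>} \<le> (1 - success TYPE('d) m k) ^ card G"
  using assms
proof (induction G rule: finite_induct)
  case empty
  interpret prob_space "ising p \<rho> \<alpha> \<beta> n :: ('d vertex \<Rightarrow> real) measure"
    by (rule prob_space_ising)
  show ?case by simp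
next
  case (insert g G)
  let ?q = "success TYPE('d) m k"
  let ?F = "{\<eta> \<in> configs n. \<forall>h\<in>G. \<not> matches (Q h) (B h) \<eta>}"
  let ?M = "{\<eta> \<in> ?F. matches (Q g) (B g) \<eta>}"
  have g: "B g \<subseteq> vertices n" "Q g \<subseteq> B g" "card (B g) = m" "card (Q g) = k"
    using insert.prems(1)[of g] by auto
  have IH: "P ?F \<le> (1 - ?q) ^ card G"
    using insert.prems insert.IH by (auto simp: disjoint_family_on_def)
  have "plant (Q g) (B g) \<eta> \<in> ?F" if "\<eta> \<in> ?F" for \<eta>
  proof -
    have "B g \<inter> B h = {}" if "h \<in> G" for h
      using insert.prems(2) insert.hyps(2) that by (auto simp: disjoint_family_on_def)
    then show ?thesis
      using that g(1) by (auto simp: plant_in_configs matches_plant_disjoint)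
  qed
  then have ge: "?q * P ?F \<le> P ?M"
    using measure_matches_ge[of "B g" "Q g" ?F] g by auto
  have "P {\<eta> \<in> configs n. \<forall>h\<in>insert g G. \<not> matches (Q h) (B h) \<eta>} = P (?F - ?M)"
    by (rule arg_cong[where f = P]) auto
  also have "\<dots> = P ?F - P ?M"
  proof -
    interpret prob_space "ising p \<rho> \<alpha> \<beta> n :: ('d vertex \<Rightarrow> real) measure"
      by (rule prob_space_ising)
    show ?thesis
      by (rule finite_measure_Diff) (auto simp: ising_def Let_def sets_point_measure)
  qed
  also have "\<dots> \<le> (1 - ?q) * P ?F"
    using ge by (simp add: algebra_simps)
  also have "\<dots> \<le> (1 - ?q) * (1 - ?q) ^ card G"
    using IH success_le_1[of "TYPE('d)"] by (intro mult_left_mono) auto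
  finally show ?case using insert.hyps by simp
qed

end

section \<open>Crowded cubes and scarce patterns\<close>

text \<open>With \<open>k\<close> outside \<open>K\<close>, this is how the first clause of
  \<open>generic\<close> fails; \<open>scarce\<close>, for patterns whose count lies in
  \<open>K\<close>, is the failure of the second.\<close>

definition crowded :: "nat \<Rightarrow> nat \<Rightarrow> nat \<Rightarrow> ('d::finite vertex \<Rightarrow> real) set" where
  "crowded n r k =
     {\<eta> \<in> configs n. \<exists>x\<in>vertices n. card {z \<in> cube r. \<eta> (translate n x z) = 1} = k}"

definition scarce :: "nat \<Rightarrow> nat \<Rightarrow> nat \<Rightarrow> (int ^ 'd::finite) set \<Rightarrow> ('d vertex \<Rightarrow> real) set" where
  "scarce n N r \<pi> = {\<eta> \<in> configs n. \<exists>F\<subseteq>vertices n. card F \<le> N \<and>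
     (\<forall>x\<in>vertices n. occurs r \<pi> n \<eta> x \<longrightarrow> F \<inter> translate n x ` cube r \<noteq> {})}"

section \<open>Disjoint cubes on a grid\<close>

text \<open>The mesh is the side of the cube, so the cubes around grid points are disjoint; rounding
  down keeps the last one clear of the first across the periodic boundary.\<close>

definition centers :: "nat \<Rightarrow> nat \<Rightarrow> 'd::finite vertex set" where
  "centers n r = {x. \<forall>i. x $ i \<in> (\<lambda>j. int ((2 * r + 1) * j)) ` {..<n div (2 * r + 1)}}"

lemma card_centers: "card (centers n r :: 'd::finite vertex set) = (n div (2 * r + 1)) ^ CARD('d)"
proof -
  have "inj_on (\<lambda>j. int ((2 * r + 1) * j)) {..<n div (2 * r + 1)}"
    unfolding inj_on_def of_nat_eq_iff mult_cancel1 by simp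
  then show ?thesis
    unfolding centers_def card_vec_set by (simp only: card_image card_lessThan)
qed

lemma center_bound:
  fixes j n r :: nat
  assumes "j < n div (2 * r + 1)"
  shows "(2 * r + 1) * j + (2 * r + 1) \<le> n"
proof -
  have "(2 * r + 1) * Suc j \<le> (2 * r + 1) * (n div (2 * r + 1))"
    using assms by (intro mult_le_mono2) auto
  also have "\<dots> \<le> n" by (rule times_div_less_eq_dividend)
  finally show ?thesis by simp
qed

lemma centers_subset: "centers n r \<subseteq> vertices n"
proof
  fix x :: "'a vertex" assume x: "x \<in> centers n r"
  have "0 \<le> x $ i \<and> x $ i < int n" for i
  proof -
    obtain j where "j < n div (2 * r + 1)" "x $ i = int ((2 * r + 1) * j)"
      using x by (auto simp: centers_def)
    then show ?thesis using center_bound[of j n r] by linarith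
  qed
  then show "x \<in> vertices n" by (simp add: vertices_def)
qed

lemma translate_centers_disjoint:
  "disjoint_family_on (\<lambda>x. translate n x ` cube r) (centers n r)"
  unfolding disjoint_family_on_def
proof (intro ballI impI)
  fix x y :: "'a vertex" assume xy: "x \<in> centers n r" "y \<in> centers n r" "x \<noteq> y"
  have False if zw: "z \<in> cube r" "w \<in> cube r" and eq: "translate n x z = translate n y w" for z w
  proof -
    let ?L = "2 * r + 1"
    obtain i where i: "x $ i \<noteq> y $ i" using xy(3) by (auto simp: vec_eq_iff)
    obtain j j' where j: "j < n div ?L" "x $ i = int (?L * j)" and j': "j' < n div ?L" "y $ i = int (?L * j')"
      using xy(1,2) unfolding centers_def by blast
    have zw_i: "\<bar>z $ i\<bar> \<le> int r" "\<bar>w $ i\<bar> \<le> int r"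
      using zw unfolding cube_def by blast+
    have "int n dvd (x $ i + z $ i) - (y $ i + w $ i)"
      using eq unfolding translate_eq_iff by blast
    \<comment> \<open>Center coordinates lie between 0 and \<open>n - (2 * r + 1)\<close>, and
      \<open>z\<close>, \<open>w\<close> add at most \<open>2 * r\<close> to a difference; so the
      congruence is an equality.\<close>
    moreover have "\<bar>(x $ i + z $ i) - (y $ i + w $ i)\<bar> < int n"
      using zw_i j(2) j'(2) center_bound[OF j(1)] center_bound[OF j'(1)] by linarith
    ultimately have eq0: "(x $ i + z $ i) - (y $ i + w $ i) = 0"
      by (rule int_dvd_small)
    have "j \<noteq> j'" using i j(2) j'(2) by auto
    \<comment> \<open>Distinct grid coordinates are at least \<open>2 * r + 1\<close> apart, one
      more than \<open>z\<close> and \<open>w\<close> can bridge.\<close>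
    then have "Suc j \<le> j' \<or> Suc j' \<le> j" by linarith
    then have "?L * Suc j \<le> ?L * j' \<or> ?L * Suc j' \<le> ?L * j"
      by (metis mult_le_mono2)
    then have "?L * j + ?L \<le> ?L * j' \<or> ?L * j' + ?L \<le> ?L * j"
      by (simp only: mult_Suc_right add.commute)
    then show False using eq0 zw_i j(2) j'(2) by linarith
  qed
  then show "translate n x ` cube r \<inter> translate n y ` cube r = {}" by blast
qed

text \<open>Enumerate \<open>T\<close> and cut the enumeration into consecutive intervals of length
  \<open>M\<close>.\<close>

lemma ex_disjoint_groups:
  assumes "finite T" "m * M \<le> card T"
  shows "\<exists>G. (\<forall>j<m. G j \<subseteq> T \<and> card (G j) = M) \<and> disjoint_family_on G {..<m}"
proof -
  obtain h where h: "bij_betw h {0..<card T} T"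
    using ex_bij_betw_nat_finite[OF assms(1)] by blast
  define I where "I j = {j * M..<j * M + M}" for j
  have I: "I j \<subseteq> {0..<card T}" if "j < m" for j
  proof -
    have "Suc j * M \<le> m * M" using that by (intro mult_le_mono1) auto
    then show ?thesis using assms(2) by (auto simp: I_def)
  qed
  have "I i \<inter> I j = {}" if "i \<noteq> j" for i j
  proof -
    have "Suc i * M \<le> j * M \<or> Suc j * M \<le> i * M"
      using that by (metis linorder_neqE_nat mult_le_mono1 Suc_leI)
    then show ?thesis by (auto simp: I_def)
  qed
  then have "h ` I i \<inter> h ` I j = {}" if "i < m" "j < m" "i \<noteq> j" for i j
    using that I h inj_on_image_Int[of h "{0..<card T}" "I i" "I j"] by (simp add: bij_betw_def)
  moreover have "h ` I j \<subseteq> T \<and> card (h ` I j) = M" if "j < m" for j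
    using I[OF that] h card_image[OF inj_on_subset, of h "{0..<card T}" "I j"]
    by (auto simp: bij_betw_def I_def)
  ultimately show ?thesis
    by (intro exI[of _ "\<lambda>j. h ` I j"]) (auto simp: disjoint_family_on_def)
qed

lemma occurs_iff_matches:
  assumes "2 * r < n" "\<pi> \<subseteq> cube r"
  shows "occurs r \<pi> n \<eta> x \<longleftrightarrow> matches (translate n x ` \<pi>) (translate n x ` cube r) \<eta>"
  using inj_on_image_mem_iff[OF inj_on_translate[OF assms(1), of x] _ assms(2)]
  by (simp add: occurs_def matches_def)

text \<open>One occurrence in each of \<open>N + 1\<close> disjoint groups of centers suffices, since each point of \<open>F\<close>
  lies in at most one of the disjoint cubes.\<close>

lemma scarce_subset:
  fixes G :: "nat \<Rightarrow> 'd::finite vertex set"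
  assumes G: "\<And>j. j \<le> N \<Longrightarrow> G j \<subseteq> centers n r" and disj: "disjoint_family_on G {..N}"
  shows "scarce n N r \<pi> \<subseteq> (\<Union>j\<le>N. {\<eta> \<in> configs n. \<forall>x\<in>G j. \<not> occurs r \<pi> n \<eta> x})"
proof
  fix \<eta> assume "\<eta> \<in> scarce n N r \<pi>"
  then obtain F where \<eta>: "\<eta> \<in> configs n" and F: "F \<subseteq> vertices n" "card F \<le> N"
    "\<And>x. x \<in> vertices n \<Longrightarrow> occurs r \<pi> n \<eta> x \<Longrightarrow> F \<inter> translate n x ` cube r \<noteq> {}"
    by (auto simp: scarce_def)
  have "\<exists>j\<le>N. \<forall>x\<in>G j. \<not> occurs r \<pi> n \<eta> x"
  proof (rule ccontr)
    assume "\<not> ?thesis"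
    then obtain x where x: "\<And>j. j \<le> N \<Longrightarrow> x j \<in> G j \<and> occurs r \<pi> n \<eta> (x j)"
      by metis
    have xc: "x j \<in> centers n r" if "j \<le> N" for j
      using x[OF that] G[OF that] by blast
    have "\<exists>y. y \<in> F \<and> y \<in> translate n (x j) ` cube r" if "j \<le> N" for j
      using F(3)[of "x j"] x[OF that] xc[OF that] centers_subset by blast
    then obtain f where f: "\<And>j. j \<le> N \<Longrightarrow> f j \<in> F \<and> f j \<in> translate n (x j) ` cube r"
      by metis
    \<comment> \<open>A point common to two cubes forces equal centers, and a common center forces
      equal groups. So \<open>F\<close> would contain \<open>N + 1\<close> points.\<close>
    have "inj_on f {..N}"
    proof (rule inj_onI)
      fix i j assume ij: "i \<in> {..N}" "j \<in> {..N}" "f i = f j"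
      then have "x i = x j"
        using translate_centers_disjoint[of n r] xc[of i] xc[of j] f[of i] f[of j]
        by (auto simp: disjoint_family_on_def)
      then show "i = j"
        using disj ij x[of i] x[of j] by (auto simp: disjoint_family_on_def)
    qed
    moreover have "f ` {..N} \<subseteq> F" using f by auto
    moreover have "finite F" using F(1) finite_vertices finite_subset by blast
    ultimately have "card {..N} \<le> card F" by (rule card_inj_on_le)
    then show False using F(2) by simp
  qed
  then show "\<eta> \<in> (\<Union>j\<le>N. {\<eta> \<in> configs n. \<forall>x\<in>G j. \<not> occurs r \<pi> n \<eta> x})"
    using \<eta> by blast
qed

section \<open>Probability bounds for the two bad events\<close>

context bounded_ising
begin

text \<open>A union bound over the position of the cube and the set of its pluses. Dropping the
  requirement of minuses elsewhere in the cube leaves an all-plus event on \<open>k\<close>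
  vertices.\<close>

lemma measure_crowded_le:
  assumes r: "2 * r < n"
  shows "P (crowded n r k :: ('d::finite vertex \<Rightarrow> real) set) \<le>
    real (n ^ CARD('d) * 2 ^ card (cube r :: (int ^ 'd) set)) *
      (exp (2 * b * real (k * card (cube c :: (int ^ 'd) set))) * exp (2 * \<alpha> * real k))"
proof -
  let ?V = "vertices n :: 'd vertex set" and ?C = "cube r :: (int ^ 'd) set"
  let ?I = "?V \<times> {\<pi> \<in> Pow ?C. card \<pi> = k}"
  let ?E = "\<lambda>(x, \<pi>). {\<eta> \<in> configs n. \<forall>y\<in>translate n x ` \<pi>. \<eta> y = 1}"
  let ?K = "exp (2 * b * real (k * card (cube c :: (int ^ 'd) set))) * exp (2 * \<alpha> * real k)"
  have finI: "finite ?I" by (simp add: finite_vertices finite_cube)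
  have "crowded n r k \<subseteq> (\<Union>i\<in>?I. ?E i)"
  proof
    fix \<eta> :: "'d vertex \<Rightarrow> real" assume "\<eta> \<in> crowded n r k"
    then obtain x where "\<eta> \<in> configs n" "x \<in> ?V" "card {z \<in> ?C. \<eta> (translate n x z) = 1} = k"
      by (auto simp: crowded_def)
    then show "\<eta> \<in> (\<Union>i\<in>?I. ?E i)"
      by (intro UN_I[of "(x, {z \<in> ?C. \<eta> (translate n x z) = 1})"]) auto
  qed
  then have "P (crowded n r k :: ('d vertex \<Rightarrow> real) set) \<le> P (\<Union>i\<in>?I. ?E i)"
    by (rule measure_ising_mono) auto
  also have "\<dots> \<le> (\<Sum>i\<in>?I. P (?E i))"
    by (rule measure_ising_subadditive[OF finI]) auto
  also have "\<dots> \<le> real (card ?I) * ?K"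
  proof (rule sum_bounded_above)
    fix i assume "i \<in> ?I"
    then obtain x \<pi> where i: "i = (x, \<pi>)" "x \<in> ?V" "\<pi> \<subseteq> ?C" "card \<pi> = k" by auto
    have "card (translate n x ` \<pi>) = k"
      using card_image[OF inj_on_subset[OF inj_on_translate[OF r] i(3)]] i(4) by simp
    moreover have "translate n x ` \<pi> \<subseteq> ?V"
      using n by (auto intro: translate_in_vertices)
    ultimately show "P (?E i) \<le> ?K"
      using measure_all_plus_le[of "translate n x ` \<pi>"] i(1) by simp
  qed
  also have "\<dots> \<le> real (n ^ CARD('d) * 2 ^ card ?C) * ?K"
  proof (rule mult_right_mono)
    have "card {\<pi> \<in> Pow ?C. card \<pi> = k} \<le> card (Pow ?C)"
      by (intro card_mono) (auto simp: finite_cube)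
    then have "card ?I \<le> n ^ CARD('d) * 2 ^ card ?C"
      by (simp only: card_cartesian_product card_vertices card_Pow[OF finite_cube] mult_le_mono2)
    then show "real (card ?I) \<le> real (n ^ CARD('d) * 2 ^ card ?C)" by (rule of_nat_mono)
  qed simp
  finally show ?thesis .
qed

text \<open>A union bound over \<open>N + 1\<close> groups of \<open>M\<close> disjoint cubes, each
  cube being one trial for the pattern.\<close>

lemma measure_scarce_le:
  fixes \<pi> :: "(int ^ 'd::finite) set"
  assumes r: "2 * r < n" and \<pi>: "\<pi> \<subseteq> cube r" and M: "Suc N * M \<le> (n div (2 * r + 1)) ^ CARD('d)"
  shows "P (scarce n N r \<pi>) \<le> real (Suc N) *
    (1 - success TYPE('d) (card (cube r :: (int ^ 'd) set)) (card \<pi>)) ^ M"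
proof -
  let ?q = "success TYPE('d) (card (cube r :: (int ^ 'd) set)) (card \<pi>)"
  have "finite (centers n r :: 'd vertex set)"
    by (rule finite_subset[OF centers_subset finite_vertices])
  moreover have "Suc N * M \<le> card (centers n r :: 'd vertex set)"
    using M by (simp add: card_centers)
  ultimately obtain G :: "nat \<Rightarrow> 'd vertex set" where
    G: "\<And>j. j \<le> N \<Longrightarrow> G j \<subseteq> centers n r \<and> card (G j) = M" and disj: "disjoint_family_on G {..N}"
    using ex_disjoint_groups[of "centers n r" "Suc N" M] unfolding less_Suc_eq_le lessThan_Suc_atMost by blast
  let ?E = "\<lambda>j. {\<eta> \<in> configs n. \<forall>x\<in>G j. \<not> occurs r \<pi> n \<eta> x}"
  have "P (scarce n N r \<pi>) \<le> P (\<Union>j\<le>N. ?E j)"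
    by (intro measure_ising_mono scarce_subset) (use G disj in auto)
  also have "\<dots> \<le> (\<Sum>j\<le>N. P (?E j))"
    by (rule measure_ising_subadditive) auto
  also have "\<dots> \<le> (\<Sum>j\<le>N. (1 - ?q) ^ M)"
  proof (rule sum_mono)
    fix j assume "j \<in> {..N}"
    then have Gj: "G j \<subseteq> centers n r" "card (G j) = M" using G by auto
    have "finite (G j)"
      by (rule finite_subset[OF subset_trans[OF Gj(1) centers_subset] finite_vertices])
    moreover have "translate n x ` cube r \<subseteq> vertices n \<and> translate n x ` \<pi> \<subseteq> translate n x ` cube r \<and>
        card (translate n x ` cube r) = card (cube r :: (int ^ 'd) set) \<and> card (translate n x ` \<pi>) = card \<pi>" for x
      using n \<pi> inj_on_translate[OF r, of x] inj_on_subset[OF inj_on_translate[OF r] \<pi>, of x]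
      by (auto intro: translate_in_vertices simp: card_image)
    moreover have "disjoint_family_on (\<lambda>x. translate n x ` cube r) (G j)"
      using disjoint_family_on_mono[OF Gj(1) translate_centers_disjoint] .
    ultimately show "P (?E j) \<le> (1 - ?q) ^ M"
      using measure_no_match_le[of "G j" "\<lambda>x. translate n x ` cube r" "\<lambda>x. translate n x ` \<pi>"] Gj(2)
      by (simp add: occurs_iff_matches[OF r \<pi>])
  qed
  finally show ?thesis by simp
qed

end


section \<open>The zero-one law\<close>

text \<open>\<open>D\<close> serves all sizes, so the period may be chosen after \<open>z\<close>,
  so large that \<open>z\<close> is congruent to no other displacement in a cube containing
  \<open>cube c\<close>. The edge that \<open>z\<close> creates also comes from a displacement in
  \<open>cube c\<close>, which must then be \<open>z\<close> itself.\<close>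

lemma displacement_in_cube:
  fixes D :: "'r \<Rightarrow> (int ^ 'd::finite) set"
  assumes "1 \<le> p" "\<rho> \<le> real c"
    and graph: "\<And>n. n \<ge> 1 \<Longrightarrow> associated_edges (vertices n) (torus_rel D n) = torus_edges p \<rho> n"
  shows "D r \<subseteq> cube c"
proof
  fix z assume z: "z \<in> D r"
  define m where "m = (\<Sum>i\<in>UNIV. nat \<bar>z $ i\<bar>)"
  define n where "n = Suc (2 * (m + c))"
  have zm: "z \<in> cube (m + c)"
  proof -
    have "nat \<bar>z $ i\<bar> \<le> m" for i
      unfolding m_def by (rule member_le_sum) auto
    then have "\<bar>z $ i\<bar> \<le> int (m + c)" for i
      using le_trans[of "nat \<bar>z $ i\<bar>" m "m + c"] by (simp add: nat_le_iff)
    then show ?thesis by (simp add: cube_def)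
  qed
  have inj: "inj_on (translate n (x :: 'd vertex)) (cube (m + c))" for x
    by (rule inj_on_translate) (simp add: n_def)
  have n: "1 \<le> n" by (simp add: n_def)
  show "z \<in> cube c"
  proof (cases "z = 0")
    case False
    define x :: "'d vertex" where "x = 0"
    define y where "y = translate n x z"
    have V: "x \<in> vertices n" "y \<in> vertices n"
      using translate_in_vertices[OF n] by (auto simp: y_def x_def vertices_def n_def)
    have "y \<noteq> x"
    proof
      assume "y = x"
      then have "translate n x z = translate n x 0"
        using V by (simp add: y_def translate_zero)
      then show False using inj_onD[OF inj _ zm zero_in_cube] False by blast
    qed
    moreover have "torus_rel D n r x y"
      using z eq_translate_iff_displacements[OF V(2), of x z] by (auto simp: torus_rel_def y_def)
    ultimately have "{x, y} \<in> torus_edges p \<rho> n"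
      using V graph[OF n] unfolding associated_edges_def by blast
    then have "torus_adj p \<rho> n x y"
      by (auto simp: torus_edges_def doubleton_eq_iff dest: torus_adj_sym)
    then obtain z' where z': "z' \<in> cube c" "y = translate n x z'"
      by (rule torus_adj_translate[OF assms(1,2) V(2)])
    have "z' \<in> cube (m + c)" using z'(1) cube_mono[of c "m + c"] by auto
    moreover have "translate n x z = translate n x z'" using z'(2) y_def by simp
    ultimately have "z = z'" using inj_onD[OF inj _ zm] by blast
    then show ?thesis using z'(1) by simp
  \<comment> \<open>A zero displacement gives only loops, which the graph does not record, but 0
    lies in every cube.\<close>
  qed (simp add: zero_in_cube)
qed

text \<open>The union is finite and its index sets do not depend on \<open>n\<close>, so limits can
  be taken term by term.\<close>

lemma not_generic_subset:
  "{\<eta> \<in> configs n. \<not> generic K N n \<eta>} \<subseteq>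
    (\<Union>r\<le>N. (\<Union>k\<in>{..card (cube r :: (int ^ 'd::finite) set)} - K. crowded n r k) \<union>
      (\<Union>\<pi>\<in>{\<pi> \<in> Pow (cube r). card \<pi> \<in> K}. scarce n N r (\<pi> :: (int ^ 'd) set)))"
proof
  fix \<eta> :: "'d vertex \<Rightarrow> real" assume "\<eta> \<in> {\<eta> \<in> configs n. \<not> generic K N n \<eta>}"
  then have \<eta>: "\<eta> \<in> configs n" and "\<not> generic K N n \<eta>" by auto
  then obtain r where r: "r \<le> N" and
    alt: "(\<exists>x\<in>vertices n. card {z \<in> cube r. \<eta> (translate n x z) = 1} \<notin> K) \<or>
      (\<exists>\<pi>\<subseteq>cube r. card \<pi> \<in> K \<and> \<eta> \<in> scarce n N r \<pi>)"
    using \<eta> unfolding generic_def scarce_def by blast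
  have "card {z \<in> cube r. \<eta> (translate n x z) = 1} \<le> card (cube r :: (int ^ 'd) set)" for x
    by (intro card_mono finite_cube) auto
  then have "\<eta> \<in> (\<Union>k\<in>{..card (cube r :: (int ^ 'd) set)} - K. crowded n r k) \<union>
      (\<Union>\<pi>\<in>{\<pi> \<in> Pow (cube r). card \<pi> \<in> K}. scarce n N r \<pi>)"
    using alt \<eta> unfolding crowded_def by blast
  then show "\<eta> \<in> (\<Union>r\<le>N. (\<Union>k\<in>{..card (cube r :: (int ^ 'd) set)} - K. crowded n r k) \<union>
      (\<Union>\<pi>\<in>{\<pi> \<in> Pow (cube r). card \<pi> \<in> K}. scarce n N r \<pi>))"
    using r by blast
qed

lemma tendsto_0_squeeze:
  fixes f g :: "nat \<Rightarrow> real"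
  assumes "g \<longlonglongrightarrow> 0" "\<And>n. m < n \<Longrightarrow> f n \<le> g n" "\<And>n. 0 \<le> f n"
  shows "f \<longlonglongrightarrow> 0"
proof (rule Lim_null_comparison[OF _ assms(1)])
  show "eventually (\<lambda>n. norm (f n) \<le> g n) sequentially"
    using assms(2,3) by (intro eventually_sequentiallyI[of "Suc m"]) simp
qed

lemma filterlim_mult_const_at_top:
  fixes f :: "nat \<Rightarrow> real"
  assumes "filterlim f at_top sequentially" "C > 0"
  shows "filterlim (\<lambda>n. C * f n) at_top sequentially"
  using assms filterlim_tendsto_pos_mult_at_top[OF tendsto_const] by blast

text \<open>Once the quotient is at least 1, rounding it down loses at most a factor 2.\<close>

lemma div_ge_half:
  assumes "1 \<le> L" "L \<le> n"
  shows "real n / (2 * real L) \<le> real (n div L)"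
proof -
  have "1 \<le> n div L"
    using assms by (simp add: Suc_leI div_greater_zero_iff)
  then have "n \<le> L * (n div L) + L * (n div L)"
    using mult_div_mod_eq[of L n] mod_less_divisor[of L n] assms(1) mult_le_mono2[of 1 "n div L" L] by linarith
  then have "real n \<le> real (L * (n div L) + L * (n div L))"
    by (rule of_nat_mono)
  then have "real n \<le> 2 * real L * real (n div L)"
    by simp
  then show ?thesis using assms(1) by (simp add: divide_le_eq mult.commute)
qed

section \<open>Limits along the sequence of tori\<close>

locale ising_sequence =
  fixes p :: ereal and \<rho> b0 :: real and a b :: "nat \<Rightarrow> real" and c :: nat
  assumes p: "1 \<le> p" and \<rho>: "\<rho> \<le> real c" and a: "\<And>n. n \<ge> 1 \<Longrightarrow> a n \<le> 0"
    and b: "\<And>n. n \<ge> 1 \<Longrightarrow> \<bar>b n\<bar> \<le> b0"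
begin

lemma bounded_ising: "n \<ge> 1 \<Longrightarrow> bounded_ising p \<rho> (a n) (b n) b0 c n"
  by unfold_locales (use p \<rho> a b in auto)

lemma crowded_tendsto_0:
  assumes lim: "(\<lambda>n. exp (2 * real k * a n) * real n ^ CARD('d::finite)) \<longlonglongrightarrow> 0"
  shows "(\<lambda>n. measure (ising p \<rho> (a n) (b n) n) (crowded n r k :: ('d vertex \<Rightarrow> real) set)) \<longlonglongrightarrow> 0"
proof -
  let ?C = "2 ^ card (cube r :: (int ^ 'd) set) * exp (2 * b0 * real (k * card (cube c :: (int ^ 'd) set)))"
  let ?f = "\<lambda>n. exp (2 * real k * a n) * real n ^ CARD('d)"
  have "(\<lambda>n. ?C * ?f n) \<longlonglongrightarrow> 0"
    using tendsto_mult_left[OF lim, of ?C] by simp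
  moreover have "measure (ising p \<rho> (a n) (b n) n) (crowded n r k :: ('d vertex \<Rightarrow> real) set) \<le> ?C * ?f n"
    if large: "2 * r < n" for n
  proof -
    interpret bounded_ising p \<rho> "a n" "b n" b0 c n using large by (intro bounded_ising) simp
    show ?thesis using measure_crowded_le[OF large, of k, where 'd = 'd] by (simp add: ac_simps)
  qed
  ultimately show ?thesis
    by (rule tendsto_0_squeeze) (assumption | rule measure_nonneg)+
qed

text \<open>Each group has on the order of n^d trials, and each trial succeeds with probability of
  order e^{2ka}. Hence \<open>q * M\<close> tends to infinity, and (1 - q)^M is at most exp(- q
  M).\<close>

lemma scarce_tendsto_0:
  fixes \<pi> :: "(int ^ 'd::finite) set"
  assumes \<pi>: "\<pi> \<subseteq> cube r"
    and lim: "filterlim (\<lambda>n. exp (2 * real (card \<pi>) * a n) * real n ^ CARD('d)) at_top sequentially"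
  shows "(\<lambda>n. measure (ising p \<rho> (a n) (b n) n) (scarce n N r \<pi>)) \<longlonglongrightarrow> 0"
proof -
  let ?m = "card (cube r :: (int ^ 'd) set)" and ?L = "2 * r + 1"
  \<comment> \<open>\<open>?A\<close> is the part of \<open>success\<close> that is free of
    \<open>n\<close>; \<open>?B\<close> accounts for the density of the grid, with rounding, and for
    the division into \<open>N + 1\<close> groups.\<close>
  let ?A = "1 / (2 ^ ?m * exp (2 * b0 * real (?m * card (cube c :: (int ^ 'd) set))))"
  let ?B = "1 / ((2 * real ?L) ^ CARD('d) * real (Suc N))"
  let ?f = "\<lambda>n. exp (2 * real (card \<pi>) * a n) * real n ^ CARD('d)"
  \<comment> \<open>The \<open>- 1\<close> pays for rounding the group size down: one trial more or
    less changes \<open>q * M\<close> by at most 1.\<close>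
  have "filterlim (\<lambda>n. - 1 + (?A * ?B) * ?f n) at_top sequentially"
    by (intro filterlim_tendsto_add_at_top[OF tendsto_const] filterlim_mult_const_at_top[OF lim]) simp
  then have "filterlim (\<lambda>n. - (- 1 + (?A * ?B) * ?f n)) at_bot sequentially"
    by (simp only: filterlim_uminus_at_bot minus_minus)
  then have "(\<lambda>n. exp (- (- 1 + (?A * ?B) * ?f n))) \<longlonglongrightarrow> 0"
    by (rule filterlim_compose[OF exp_at_bot])
  then have "(\<lambda>n. real (Suc N) * exp (- (- 1 + (?A * ?B) * ?f n))) \<longlonglongrightarrow> 0"
    by (rule tendsto_mult_right_zero)
  moreover have "measure (ising p \<rho> (a n) (b n) n) (scarce n N r \<pi>)
      \<le> real (Suc N) * exp (- (- 1 + (?A * ?B) * ?f n))" if large: "2 * r < n" for n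
  proof -
    interpret bounded_ising p \<rho> "a n" "b n" b0 c n using large by (intro bounded_ising) simp
    let ?q = "success TYPE('d) ?m (card \<pi>)" and ?T = "(n div ?L) ^ CARD('d)"
    define M where "M = ?T div Suc N"
    have q: "0 < ?q" "?q \<le> 1" by (rule success_pos success_le_1)+
    have q_eq: "?q = ?A * exp (2 * real (card \<pi>) * a n)"
      by (simp add: success_def mult.assoc mult.left_commute[of "a n"] mult.commute[of "a n"])
    have "(real n / (2 * real ?L)) ^ CARD('d) \<le> real (n div ?L) ^ CARD('d)"
      using large by (intro power_mono div_ge_half) auto
    then have T: "real n ^ CARD('d) / (2 * real ?L) ^ CARD('d) \<le> real ?T"
      by (simp add: power_divide)
    have "real ?T / real (Suc N) \<le> real M + 1"
    proof -
      have "?T \<le> Suc N * M + Suc N"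
        using mult_div_mod_eq[of "Suc N" ?T] mod_less_divisor[of "Suc N" ?T] unfolding M_def by linarith
      then have "real ?T \<le> real (Suc N * M + Suc N)" by (rule of_nat_mono)
      also have "\<dots> = (real M + 1) * real (Suc N)" by (simp add: algebra_simps)
      finally show ?thesis by (simp only: pos_divide_le_eq of_nat_0_less_iff zero_less_Suc)
    qed
    then have "?q * (real ?T / real (Suc N)) \<le> ?q * (real M + 1)"
      using q by (intro mult_left_mono) auto
    also have "\<dots> \<le> ?q * real M + 1"
      using q by (simp add: distrib_left)
    finally have "?q * (real ?T / real (Suc N)) \<le> ?q * real M + 1" .
    moreover have "(?A * ?B) * ?f n \<le> ?q * (real ?T / real (Suc N))"
    proof -
      have "(?A * ?B) * ?f n = ?q * (real n ^ CARD('d) / (2 * real ?L) ^ CARD('d) / real (Suc N))"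
        unfolding q_eq by (simp add: field_simps)
      also have "\<dots> \<le> ?q * (real ?T / real (Suc N))"
        using q by (intro mult_left_mono divide_right_mono T) auto
      finally show ?thesis .
    qed
    ultimately have le: "- (?q * real M) \<le> - (- 1 + (?A * ?B) * ?f n)" by linarith
    have "Suc N * M \<le> ?T" unfolding M_def by (rule times_div_less_eq_dividend)
    then have "P (scarce n N r \<pi>) \<le> real (Suc N) * (1 - ?q) ^ M"
      by (rule measure_scarce_le[OF large \<pi>])
    also have "\<dots> \<le> real (Suc N) * exp (- ?q) ^ M"
      using q exp_ge_add_one_self[of "- ?q"] by (intro mult_left_mono power_mono) auto
    also have "\<dots> = real (Suc N) * exp (- (?q * real M))"
      by (simp add: exp_of_nat_mult[symmetric] mult.commute)
    also have "\<dots> \<le> real (Suc N) * exp (- (- 1 + (?A * ?B) * ?f n))"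
      using le by (intro mult_left_mono) auto
    finally show ?thesis .
  qed
  ultimately show ?thesis
    by (rule tendsto_0_squeeze) (assumption | rule measure_nonneg)+
qed

lemma not_generic_tendsto_0:
  assumes K: "\<And>k. k \<in> K \<Longrightarrow>
      filterlim (\<lambda>n. exp (2 * real k * a n) * real n ^ CARD('d::finite)) at_top sequentially"
    and not_K: "\<And>k. k \<notin> K \<Longrightarrow> (\<lambda>n. exp (2 * real k * a n) * real n ^ CARD('d)) \<longlonglongrightarrow> 0"
  shows "(\<lambda>n. measure (ising p \<rho> (a n) (b n) n)
      {\<eta> \<in> configs n. \<not> generic K N n (\<eta> :: 'd vertex \<Rightarrow> real)}) \<longlonglongrightarrow> 0"
proof -
  let ?\<mu> = "\<lambda>n. measure (ising p \<rho> (a n) (b n) n :: ('d vertex \<Rightarrow> real) measure)"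
  let ?k = "\<lambda>r. {..card (cube r :: (int ^ 'd) set)} - K"
  let ?\<pi> = "\<lambda>r. {\<pi> \<in> Pow (cube r :: (int ^ 'd) set). card \<pi> \<in> K}"
  let ?s = "\<lambda>n. \<Sum>r\<le>N. (\<Sum>k\<in>?k r. ?\<mu> n (crowded n r k)) + (\<Sum>\<pi>\<in>?\<pi> r. ?\<mu> n (scarce n N r \<pi>))"
  have "?s \<longlonglongrightarrow> (\<Sum>r\<le>N. (\<Sum>k\<in>?k r. 0) + (\<Sum>\<pi>\<in>?\<pi> r. 0))"
    by (intro tendsto_sum tendsto_add crowded_tendsto_0 scarce_tendsto_0) (auto intro: K not_K)
  then have "?s \<longlonglongrightarrow> 0" by simp
  moreover have "?\<mu> n {\<eta> \<in> configs n. \<not> generic K N n \<eta>} \<le> ?s n" if n: "0 < n" for n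
  proof -
    interpret bounded_ising p \<rho> "a n" "b n" b0 c n using n by (intro bounded_ising) simp
    let ?X = "\<lambda>r. \<Union>k\<in>?k r. crowded n r k :: ('d vertex \<Rightarrow> real) set"
    let ?Y = "\<lambda>r. \<Union>\<pi>\<in>?\<pi> r. scarce n N r \<pi>"
    have sub: "(crowded n r k :: ('d vertex \<Rightarrow> real) set) \<subseteq> configs n" "scarce n N r \<pi> \<subseteq> configs n"
      for r k and \<pi> :: "(int ^ 'd) set"
      by (auto simp: crowded_def scarce_def)
    have "P {\<eta> \<in> configs n. \<not> generic K N n (\<eta> :: 'd vertex \<Rightarrow> real)} \<le> P (\<Union>r\<le>N. ?X r \<union> ?Y r)"
      using sub by (intro measure_ising_mono not_generic_subset) (simp add: UN_subset_iff)
    also have "\<dots> \<le> (\<Sum>r\<le>N. P (?X r \<union> ?Y r))"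
      using sub by (intro measure_ising_subadditive) (simp_all add: UN_subset_iff)
    also have "\<dots> \<le> ?s n"
    proof (rule sum_mono)
      fix r
      have "P (?X r \<union> ?Y r) \<le> P (?X r) + P (?Y r)"
        using sub by (intro measure_ising_Un_le) (simp_all add: UN_subset_iff)
      also have "\<dots> \<le> (\<Sum>k\<in>?k r. P (crowded n r k :: ('d vertex \<Rightarrow> real) set)) + (\<Sum>\<pi>\<in>?\<pi> r. P (scarce n N r \<pi>))"
        using sub by (intro add_mono measure_ising_subadditive) (simp_all add: finite_cube)
      finally show "P (?X r \<union> ?Y r)
        \<le> (\<Sum>k\<in>?k r. P (crowded n r k :: ('d vertex \<Rightarrow> real) set)) + (\<Sum>\<pi>\<in>?\<pi> r. P (scarce n N r \<pi>))" .
    qed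
    finally show ?thesis .
  qed
  ultimately show ?thesis
    by (rule tendsto_0_squeeze) (assumption | rule measure_nonneg)+
qed

end

text \<open>This explains the exponent d/(2k) of the hypothesis: since a plus costs e^{2a}, the
  2k-th power is the order of the expected number of cubes with \<open>k\<close> pluses.\<close>

lemma power_threshold:
  assumes "n \<ge> 1" "k \<ge> 1"
  shows "(exp x * real n powr (real d / (2 * real k))) ^ (2 * k) = exp (2 * real k * x) * real n ^ d"
proof -
  have "exp x ^ (2 * k) = exp (2 * real k * x)"
    using exp_of_nat_mult[of "2 * k" x] by simp
  moreover have "(real n powr (real d / (2 * real k))) ^ (2 * k) = real n ^ d"
    using assms by (simp add: powr_power powr_realpow)
  ultimately show ?thesis by (simp only: power_mult_distrib)
qed

theorem theorem4p1:
  fixes p :: ereal and \<rho> :: real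
    and a b :: "nat \<Rightarrow> real"
    and D :: "'r \<Rightarrow> (int ^ 'd::finite) set"
    and A :: "'r fm"
  assumes p: "1 \<le> p"
    and graph: "\<And>n. n \<ge> 1 \<Longrightarrow>
      associated_edges (vertices n) (torus_rel D n) = torus_edges p \<rho> n"
    and a_neg: "\<And>n. n \<ge> 1 \<Longrightarrow> a n < 0"
    and b_bdd: "\<exists>b0>0. \<forall>n\<ge>1. \<bar>b n\<bar> < b0"
    and lim: "\<And>k::nat. k \<ge> 1 \<Longrightarrow>
      (\<lambda>n. exp (a n) * real n powr (real CARD('d) / (2 * real k))) \<longlonglongrightarrow> 0 \<or>
      filterlim (\<lambda>n. exp (a n) * real n powr (real CARD('d) / (2 * real k))) at_top sequentially"
    and A: "sentence A"
  shows "(\<lambda>n. measure (ising p \<rho> (a n) (b n) n) (event D n A)) \<longlonglongrightarrow> 0 \<or>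
         (\<lambda>n. measure (ising p \<rho> (a n) (b n) n) (event D n A)) \<longlonglongrightarrow> 1"
proof -
  obtain b0 where b0: "\<forall>n\<ge>1. \<bar>b n\<bar> < b0" using b_bdd by blast
  \<comment> \<open>For negative \<open>\<rho>\<close> this is 0, and the bound below still
    holds.\<close>
  define c where "c = nat \<lceil>\<rho>\<rceil>"
  have c: "\<rho> \<le> real c" unfolding c_def by linarith
  interpret ising_sequence p \<rho> b0 a b c
    by unfold_locales (use p c a_neg b0 in \<open>auto intro: less_imp_le\<close>)
  have D: "D r \<subseteq> cube c" for r
    by (rule displacement_in_cube[OF p c graph])
  let ?f = "\<lambda>k n. exp (2 * real k * a n) * real n ^ CARD('d)"
  \<comment> \<open>\<open>K\<close> is fixed by the limits alone, hence common to all sizes; this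
    allows configurations on different tori to be compared.\<close>
  define K where "K = {k. filterlim (?f k) at_top sequentially}"
  have f_eq: "eventually (\<lambda>n. (exp (a n) * real n powr (real CARD('d) / (2 * real k))) ^ (2 * k) = ?f k n) sequentially"
    if "k \<ge> 1" for k
    by (rule eventually_sequentiallyI[of 1]) (rule power_threshold[OF _ that])
  have not_K: "?f k \<longlonglongrightarrow> 0" if "k \<notin> K" for k
  proof -
    \<comment> \<open>The hypothesis starts at \<open>k = 1\<close>. For \<open>k = 0\<close> the
      quantity is n^d, so patterns without pluses belong to the frequent ones.\<close>
    have "filterlim (?f 0) at_top sequentially"
      using filterlim_pow_at_top[OF zero_less_card_finite filterlim_real_sequentially] by simp
    then have k: "k \<ge> 1" using that by (cases k) (auto simp: K_def)
    have "\<not> filterlim (\<lambda>n. exp (a n) * real n powr (real CARD('d) / (2 * real k))) at_top sequentially"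
    proof
      assume "filterlim (\<lambda>n. exp (a n) * real n powr (real CARD('d) / (2 * real k))) at_top sequentially"
      then have "filterlim (\<lambda>n. (exp (a n) * real n powr (real CARD('d) / (2 * real k))) ^ (2 * k)) at_top sequentially"
        using k by (intro filterlim_pow_at_top) auto
      then have "k \<in> K"
        unfolding K_def by (simp only: mem_Collect_eq filterlim_cong[OF refl refl f_eq[OF k]])
      then show False using that by simp
    qed
    then have "(\<lambda>n. (exp (a n) * real n powr (real CARD('d) / (2 * real k))) ^ (2 * k)) \<longlonglongrightarrow> 0 ^ (2 * k)"
      using lim[OF k] by (intro tendsto_power) blast
    then show ?thesis
      using k by (simp add: tendsto_cong[OF f_eq[OF k]] power_0_left)
  qed
  \<comment> \<open>\<open>N\<close> has two roles: it bounds the radii, the largest being the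
    starting one, and the number of vertices to be avoided.\<close>
  define N where "N = max (complexity A) (2 ^ complexity A * c)"
  have N: "complexity A \<le> N" "2 ^ complexity A * c \<le> N" by (auto simp: N_def)
  let ?\<mu> = "\<lambda>n. measure (ising p \<rho> (a n) (b n) n :: ('d vertex \<Rightarrow> real) measure)"
  let ?bad = "\<lambda>n. {\<eta> \<in> configs n. \<not> generic K N n (\<eta> :: 'd vertex \<Rightarrow> real)}"
  have bad: "(\<lambda>n. ?\<mu> n (?bad n)) \<longlonglongrightarrow> 0"
    by (rule not_generic_tendsto_0) (use not_K in \<open>auto simp: K_def\<close>)
  \<comment> \<open>One large generic model of \<open>A\<close> forces \<open>A\<close> on all large
    generic configurations; if there is none, \<open>A\<close> can hold only on non-generic ones.
    The bad event bounds the error either way.\<close>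
  show ?thesis
  proof (cases "\<exists>m>2 * N. \<exists>\<xi>. generic K N m \<xi> \<and> models D m \<xi> A")
    case True
    then obtain m \<xi> where m: "2 * N < m" "generic K N m \<xi>" "models D m \<xi> A" by blast
    have "1 - ?\<mu> n (?bad n) \<le> ?\<mu> n (event D n A)" if large: "2 * N < n" for n
    proof -
      interpret bounded_ising p \<rho> "a n" "b n" b0 c n using large by (intro bounded_ising) simp
      interpret prob_space "ising p \<rho> (a n) (b n) n :: ('d vertex \<Rightarrow> real) measure"
        by (rule prob_space_ising)
      have space: "space (ising p \<rho> (a n) (b n) n :: ('d vertex \<Rightarrow> real) measure) = configs n"
        and sets: "sets (ising p \<rho> (a n) (b n) n :: ('d vertex \<Rightarrow> real) measure) = Pow (configs n)"
        by (simp_all add: ising_def Let_def space_point_measure sets_point_measure)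
      have "1 - P (?bad n) = P (configs n - ?bad n)"
        using prob_compl[of "?bad n"] by (simp add: space sets)
      also have "\<dots> \<le> P (event D n A)"
        using models_generic_cong[OF D m(2) _ m(1) large A N] m(3)
        by (intro measure_ising_mono) (auto simp: event_def)
      finally show ?thesis .
    qed
    then have "1 - ?\<mu> n (event D n A) \<le> ?\<mu> n (?bad n)" if "2 * N < n" for n
      using that by (simp add: diff_le_eq add.commute)
    with bad have "(\<lambda>n. 1 - ?\<mu> n (event D n A)) \<longlonglongrightarrow> 0"
      by (rule tendsto_0_squeeze) (assumption | simp add: prob_space.prob_le_1[OF prob_space_ising])+
    from tendsto_diff[OF tendsto_const[of 1] this] show ?thesis by simp
  next
    case False
    have "?\<mu> n (event D n A) \<le> ?\<mu> n (?bad n)" if large: "2 * N < n" for n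
    proof -
      interpret bounded_ising p \<rho> "a n" "b n" b0 c n using large by (intro bounded_ising) simp
      show ?thesis
        using False large by (intro measure_ising_mono) (auto simp: event_def)
    qed
    with bad have "(\<lambda>n. ?\<mu> n (event D n A)) \<longlonglongrightarrow> 0"
      by (rule tendsto_0_squeeze) (assumption | rule measure_nonneg)+
    then show ?thesis ..
  qed
qed

end
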